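(* There is a real constant $c>0$ such that for infinitely many positive integers $n$ there exists a circulant graph of order $n$ whose Weisfeiler-Leman dimension is at least $c\sqrt{\log n}$.
   Context: Graphs may be directed or undirected. For a group $G$ and $X\subseteq G$, the Cayley graph $\mathrm{Cay}(G,X)$ has vertex set $G$ and arcs $(x,y)$ with $yx^{-1}\in X$. A circulant graph is a Cayley graph of a cyclic group. $m$-dimensional Weisfeiler-Leman ($m$-dim WL) algorithm, $m\ge 2$: for a graph with vertex set $\Omega$ and arc set $E$, the initial color of $x\in\Omega^m$ encodes, for all $1\le i,j\le m$, whether $x_i=x_j$ and whether $(x_i,x_j)\in E$. In each step the color $c(x)$ is replaced by the pair consisting of $c(x)$ and the multiset, over $\alpha\in\Omega$, of the tuples $(c(x_{1\leftarrow\alpha}),\ldots,c(x_{m\leftarrow\alpha}))$, where $x_{i\leftarrow\alpha}$ is $x$ with the $i$-th entry replaced by $\alpha$; this is repeated until the partition of $\Omega^m$ into color classes stabilizes. For $m=1$ the algorithm is the usual (naive) vertex color refinement. Two graphs are $\mathrm{WL}_m$-equivalent if, when the algorithm is run in parallel on both, every color occurs equally often in both. The Weisfeiler-Leman dimension of a graph $\mathcal{G}$ is the smallest positive integer $m$ such that every graph $\mathrm{WL}_m$-equivalent to $\mathcal{G}$ is isomorphic to $\mathcal{G}$. *)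

theory Defs
  imports
    Complex_Main
    "HOL-Library.Multiset"
    "HOL-Algebra.Elementary_Groups"
    "Graph_Theory.Pair_Digraph"
    "Graph_Theory.Digraph_Isomorphism"
begin

text \<open>
  Graphs are \<^typ>\<open>'a pair_pre_digraph\<close>s, i.e. directed graphs without parallel arcs, possibly with
  loops; an undirected graph is one whose arc relation is symmetric.
\<close>

definition cayley_graph :: "'a monoid \<Rightarrow> 'a set \<Rightarrow> 'a pair_pre_digraph" where
  "cayley_graph G X =
     \<lparr> pverts = carrier G,
       parcs = {(x, y). x \<in> carrier G \<and> y \<in> carrier G \<and> y \<otimes>\<^bsub>G\<^esub> inv\<^bsub>G\<^esub> x \<in> X} \<rparr>"

definition circulant :: "'a pair_pre_digraph \<Rightarrow> bool" where
  "circulant \<Gamma> \<longleftrightarrow>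
     (\<exists>G X. group G \<and> cyclic_group G \<and> X \<subseteq> carrier G \<and> \<Gamma> = cayley_graph G X)"

text \<open>
  Colours are kept as formal terms and never renamed, so colours computed on different graphs can
  be compared directly; this is what running the algorithm in parallel on two graphs amounts to.
  \<open>Naive_Step\<close> is used in dimension 1 only; its two multisets collect the colours of the
  out-neighbours and of the in-neighbours, which coincide if the graph is undirected.
\<close>

datatype colour =
    Atomic "(nat \<times> nat) set" "(nat \<times> nat) set"
  | Step colour "colour list multiset"
  | Naive_Step colour "colour multiset" "colour multiset"

definition tuples :: "nat \<Rightarrow> 'a pair_pre_digraph \<Rightarrow> 'a list set" where
  "tuples m \<Gamma> = {x. length x = m \<and> set x \<subseteq> pverts \<Gamma>}"

definition atomic_colour :: "nat \<Rightarrow> 'a pair_pre_digraph \<Rightarrow> 'a list \<Rightarrow> colour" where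
  "atomic_colour m \<Gamma> x =
     Atomic {(i, j). i < m \<and> j < m \<and> x ! i = x ! j}
            {(i, j). i < m \<and> j < m \<and> (x ! i, x ! j) \<in> parcs \<Gamma>}"

definition refine ::
    "nat \<Rightarrow> 'a pair_pre_digraph \<Rightarrow> ('a list \<Rightarrow> colour) \<Rightarrow> 'a list \<Rightarrow> colour" where
  "refine m \<Gamma> c x =
     (if m = 1
      then Naive_Step (c x)
             {# c [y]. y \<in># mset_set {y \<in> pverts \<Gamma>. (x ! 0, y) \<in> parcs \<Gamma>} #}
             {# c [y]. y \<in># mset_set {y \<in> pverts \<Gamma>. (y, x ! 0) \<in> parcs \<Gamma>} #}
      else Step (c x)
             {# map (\<lambda>i. c (x[i := \<alpha>])) [0..<m]. \<alpha> \<in># mset_set (pverts \<Gamma>) #})"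

primrec wl_colour :: "nat \<Rightarrow> 'a pair_pre_digraph \<Rightarrow> nat \<Rightarrow> 'a list \<Rightarrow> colour" where
  "wl_colour m \<Gamma> 0 = atomic_colour m \<Gamma>"
| "wl_colour m \<Gamma> (Suc r) = refine m \<Gamma> (wl_colour m \<Gamma> r)"

text \<open>
  The partition of the tuples of both graphs, taken together, is the same after round \<open>r\<close> and after
  round \<open>r + 1\<close>.
\<close>

definition wl_stable :: "nat \<Rightarrow> 'a pair_pre_digraph \<Rightarrow> 'a pair_pre_digraph \<Rightarrow> nat \<Rightarrow> bool" where
  "wl_stable m \<Gamma> \<Delta> r \<longleftrightarrow>
     (\<forall>A \<in> {\<Gamma>, \<Delta>}. \<forall>B \<in> {\<Gamma>, \<Delta>}. \<forall>x \<in> tuples m A. \<forall>y \<in> tuples m B.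
        wl_colour m A (Suc r) x = wl_colour m B (Suc r) y \<longleftrightarrow>
        wl_colour m A r x = wl_colour m B r y)"

definition wl_rounds :: "nat \<Rightarrow> 'a pair_pre_digraph \<Rightarrow> 'a pair_pre_digraph \<Rightarrow> nat" where
  "wl_rounds m \<Gamma> \<Delta> = (LEAST r. wl_stable m \<Gamma> \<Delta> r)"

definition wl_equivalent :: "nat \<Rightarrow> 'a pair_pre_digraph \<Rightarrow> 'a pair_pre_digraph \<Rightarrow> bool" where
  "wl_equivalent m \<Gamma> \<Delta> \<longleftrightarrow>
     (\<forall>k. card {x \<in> tuples m \<Gamma>. wl_colour m \<Gamma> (wl_rounds m \<Gamma> \<Delta>) x = k} =
          card {x \<in> tuples m \<Delta>. wl_colour m \<Delta> (wl_rounds m \<Gamma> \<Delta>) x = k})"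

text \<open>
  Restricting to vertices in \<^typ>\<open>nat\<close> loses nothing: every finite graph is isomorphic to such a
  graph, and colour multiplicities are invariant under isomorphism. The \<open>LEAST\<close> is always
  attained for finite \<open>\<Gamma>\<close>: for \<open>m \<ge> 2\<close> at least the number of vertices, the initial colour of a
  tuple listing all vertices already determines the graph up to isomorphism.
\<close>

definition wl_dimension :: "nat pair_pre_digraph \<Rightarrow> nat" where
  "wl_dimension \<Gamma> =
     (LEAST m. 0 < m \<and>
        (\<forall>\<Delta> :: nat pair_pre_digraph.
           pair_fin_digraph \<Delta> \<and> wl_equivalent m \<Gamma> \<Delta> \<longrightarrow>
           digraph_iso (with_proj \<Delta>) (with_proj \<Gamma>)))"

end

theory Submission
  imports
    Defs
    "HOL-Number_Theory.Cong"
begin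

text \<open>
  The construction of Cai, Furer and Immerman over the \<open>k \<times> k\<close> grid is carried out inside a cyclic
  group. The group is \<open>\<int>\<^sub>q \<times> \<int>\<^sub>g\<close> with \<open>q\<close> a power of 2 and \<open>g\<close> a power of \<open>3 \<cdot> 5 \<cdot> 7 \<cdot> 11\<close>. The first factor
  merely lets a single connection set encode many relations on the second one. Each grid edge is a
  level \<open>p\<^sup>a\<close> with \<open>p \<in> {3, 5, 7, 11}\<close>; multiplying the differences of exact valuation \<open>a\<close> by \<open>-1\<close>
  plays the role of twisting that edge. The relation attached to a grid vertex requires its incident
  edges to be exact levels of a difference and prescribes the product of the signs of the leading
  digits. Prescribing \<open>-1\<close> instead of \<open>1\<close> at a single vertex gives a graph that is not isomorphic to
  the first: an isomorphism would yield edge signs whose product over the edges at each vertex is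
  prescribed, and every edge is counted at exactly two vertices.

  The \<open>p\<close>-adic distances are ultrametrics, hence \<open>m + 1\<close> points realise at most \<open>m\<close> levels of each \<open>p\<close>.
  If \<open>2 m < k\<close>, some row and some column of the grid contain no realised level, so the inconsistency
  can be hidden at their crossing, and moved from there along unrealised levels to the next hiding
  place. This makes \<open>m\<close>-dimensional Weisfeiler-Leman fail, while the logarithm of the order of the
  group is only quadratic in \<open>k\<close>.
\<close>

section \<open>A pebble game for Weisfeiler-Leman equivalence\<close>

lemma finite_tuples: "finite (pverts \<Gamma>) \<Longrightarrow> finite (tuples m \<Gamma>)"
  unfolding tuples_def using finite_lists_length_eq[of "pverts \<Gamma>" m]
  by (simp add: conj_commute)

lemma tuples_Suc:
  "tuples (Suc l) \<Gamma> = (\<lambda>(a, x). a # x) ` (pverts \<Gamma> \<times> tuples l \<Gamma>)"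
  by (auto simp: tuples_def length_Suc_conv image_iff)

text \<open>\<open>Q\<close> holds the winning positions of the duplicator in Hella's bijective game
  with \<open>m + 1\<close> pebbles. A new pebble is prefixed to the list, so positions of length
  \<open>m + 1\<close> occur; \<open>restrict\<close> removes, permutes and repeats pebbles.\<close>

locale wl_game =
  fixes \<Gamma> \<Delta> :: "'a pair_pre_digraph" and m :: nat and Q :: "'a list \<Rightarrow> 'a list \<Rightarrow> bool"
  assumes fin: "finite (pverts \<Gamma>)" "finite (pverts \<Delta>)"
    and nil: "Q [] []"
    and eq_iff: "Q x y \<Longrightarrow> set x \<subseteq> pverts \<Gamma> \<Longrightarrow> set y \<subseteq> pverts \<Delta> \<Longrightarrow> i < length x \<Longrightarrow> j < length x \<Longrightarrow> x ! i = x ! j \<longleftrightarrow> y ! i = y ! j"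
    and arc_iff: "Q x y \<Longrightarrow> set x \<subseteq> pverts \<Gamma> \<Longrightarrow> set y \<subseteq> pverts \<Delta> \<Longrightarrow> i < length x \<Longrightarrow> j < length x \<Longrightarrow>
      (x ! i, x ! j) \<in> parcs \<Gamma> \<longleftrightarrow> (y ! i, y ! j) \<in> parcs \<Delta>"
    and extend: "Q x y \<Longrightarrow> length x \<le> m \<Longrightarrow> length y = length x \<Longrightarrow>
      set x \<subseteq> pverts \<Gamma> \<Longrightarrow> set y \<subseteq> pverts \<Delta> \<Longrightarrow>
      \<exists>\<phi>. bij_betw \<phi> (pverts \<Gamma>) (pverts \<Delta>) \<and> (\<forall>\<alpha>\<in>pverts \<Gamma>. Q (\<alpha> # x) (\<phi> \<alpha> # y))"
    and restrict: "Q x y \<Longrightarrow> length y = length x \<Longrightarrow> set is \<subseteq> {..<length x} \<Longrightarrow>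
      Q (map ((!) x) is) (map ((!) y) is)"
begin

lemma replace_one:
  assumes "Q (\<alpha> # x) (\<beta> # y)" "length y = length x" "i < length x"
  shows "Q (x[i := \<alpha>]) (y[i := \<beta>])"
proof -
  \<comment> \<open>Place \<open>i\<close> reads the new head; all other places skip it by the shift
    \<open>Suc\<close>.\<close>
  define js where "js = (map Suc [0..<length x])[i := 0]"
  have js: "set js \<subseteq> {..<length (\<alpha> # x)}"
    using set_update_subset_insert[of "map Suc [0..<length x]" i 0]
    by (auto simp: js_def)
  have "map ((!) (a # z)) js = z[i := a]" if "length z = length x" for a :: 'a and z
    using assms(3) that
    by (auto intro!: nth_equalityI simp: js_def nth_list_update map_update)
  with restrict[OF assms(1) _ js] assms(2) show ?thesis by simp
qed

text \<open>Induction on the rounds: the bijection from \<open>extend\<close> matches the two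
  refinement multisets entry by entry. For \<open>m = 1\<close> it also matches out-neighbours and
  in-neighbours, by \<open>arc_iff\<close> for positions of length 2.\<close>

lemma colour_eq:
  assumes "Q x y" "x \<in> tuples m \<Gamma>" "y \<in> tuples m \<Delta>"
  shows "wl_colour m \<Gamma> r x = wl_colour m \<Delta> r y"
  using assms
proof (induction r arbitrary: x y)
  case 0
  then show ?case
    using eq_iff[OF 0(1)] arc_iff[OF 0(1)]
    by (auto simp: atomic_colour_def tuples_def)
next
  case (Suc r)
  have xs: "length x = m" "length y = m" "set x \<subseteq> pverts \<Gamma>" "set y \<subseteq> pverts \<Delta>"
    using Suc.prems by (auto simp: tuples_def)
  obtain \<phi> where \<phi>: "bij_betw \<phi> (pverts \<Gamma>) (pverts \<Delta>)"
    and Q\<phi>: "\<And>\<alpha>. \<alpha> \<in> pverts \<Gamma> \<Longrightarrow> Q (\<alpha> # x) (\<phi> \<alpha> # y)"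
    using extend[OF Suc.prems(1)] xs by auto
  have in_V: "\<phi> \<alpha> \<in> pverts \<Delta>" if "\<alpha> \<in> pverts \<Gamma>" for \<alpha>
    using \<phi> that by (rule bij_betw_apply)
  have step: "wl_colour m \<Gamma> r (x[i := \<alpha>]) = wl_colour m \<Delta> r (y[i := \<phi> \<alpha>])"
    if "\<alpha> \<in> pverts \<Gamma>" "i < m" for \<alpha> i
  proof (rule Suc.IH)
    show "Q (x[i := \<alpha>]) (y[i := \<phi> \<alpha>])"
      using replace_one[OF Q\<phi>[OF that(1)]] xs that(2) by simp
    show "x[i := \<alpha>] \<in> tuples m \<Gamma>" "y[i := \<phi> \<alpha>] \<in> tuples m \<Delta>"
      using xs that in_V[OF that(1)] set_update_subset_insert[of x i \<alpha>]
        set_update_subset_insert[of y i "\<phi> \<alpha>"]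
      by (auto simp: tuples_def)
  qed
  have same: "wl_colour m \<Gamma> r x = wl_colour m \<Delta> r y"
    by (rule Suc.IH[OF Suc.prems])
  show ?case
  proof (cases "m = 1")
    case False
    have "{# map (\<lambda>i. wl_colour m \<Delta> r (y[i := \<beta>])) [0..<m]. \<beta> \<in># mset_set (pverts \<Delta>) #} =
          {# map (\<lambda>i. wl_colour m \<Delta> r (y[i := \<phi> \<alpha>])) [0..<m]. \<alpha> \<in># mset_set (pverts \<Gamma>) #}"
    proof -
      have "mset_set (pverts \<Delta>) = image_mset \<phi> (mset_set (pverts \<Gamma>))"
        using \<phi> image_mset_mset_set[of \<phi> "pverts \<Gamma>"] by (simp add: bij_betw_def)
      then show ?thesis by (simp only: multiset.map_comp comp_def)
    qed
    also have "\<dots> = {# map (\<lambda>i. wl_colour m \<Gamma> r (x[i := \<alpha>])) [0..<m]. \<alpha> \<in># mset_set (pverts \<Gamma>) #}"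
      using fin step by (intro image_mset_cong) simp
    finally show ?thesis using False same by (simp add: refine_def)
  next
    case True
    have x0: "x = [x ! 0]" "y = [y ! 0]"
      using xs True by (auto simp: length_Suc_conv)
    have arcs: "(x ! 0, \<alpha>) \<in> parcs \<Gamma> \<longleftrightarrow> (y ! 0, \<phi> \<alpha>) \<in> parcs \<Delta>"
               "(\<alpha>, x ! 0) \<in> parcs \<Gamma> \<longleftrightarrow> (\<phi> \<alpha>, y ! 0) \<in> parcs \<Delta>"
      if "\<alpha> \<in> pverts \<Gamma>" for \<alpha>
      using arc_iff[OF Q\<phi>[OF that], of 1 0] arc_iff[OF Q\<phi>[OF that], of 0 1] xs that in_V[OF that] True
      by auto
    have transfer: "{# wl_colour m \<Delta> r [\<beta>]. \<beta> \<in># mset_set {\<beta> \<in> pverts \<Delta>. B \<beta>} #} =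
        {# wl_colour m \<Gamma> r [\<alpha>]. \<alpha> \<in># mset_set {\<alpha> \<in> pverts \<Gamma>. A \<alpha>} #}"
      if "\<And>\<alpha>. \<alpha> \<in> pverts \<Gamma> \<Longrightarrow> A \<alpha> \<longleftrightarrow> B (\<phi> \<alpha>)" for A B
    proof -
      have "bij_betw \<phi> {\<alpha> \<in> pverts \<Gamma>. A \<alpha>} {\<beta> \<in> pverts \<Delta>. B \<beta>}"
        using \<phi> that by (intro bij_betw_Collect) auto
      then have "mset_set {\<beta> \<in> pverts \<Delta>. B \<beta>} = image_mset \<phi> (mset_set {\<alpha> \<in> pverts \<Gamma>. A \<alpha>})"
        using image_mset_mset_set[of \<phi> "{\<alpha> \<in> pverts \<Gamma>. A \<alpha>}"] by (simp add: bij_betw_def)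
      then have "{# wl_colour m \<Delta> r [\<beta>]. \<beta> \<in># mset_set {\<beta> \<in> pverts \<Delta>. B \<beta>} #} =
        {# wl_colour m \<Delta> r [\<phi> \<alpha>]. \<alpha> \<in># mset_set {\<alpha> \<in> pverts \<Gamma>. A \<alpha>} #}"
        by (simp only: multiset.map_comp comp_def)
      also have "\<dots> = {# wl_colour m \<Gamma> r [\<alpha>]. \<alpha> \<in># mset_set {\<alpha> \<in> pverts \<Gamma>. A \<alpha>} #}"
      proof (intro image_mset_cong)
        fix \<alpha> assume "\<alpha> \<in># mset_set {\<alpha> \<in> pverts \<Gamma>. A \<alpha>}"
        then have "\<alpha> \<in> pverts \<Gamma>" using fin by simp
        from step[OF this, of 0] True x0 show "wl_colour m \<Delta> r [\<phi> \<alpha>] = wl_colour m \<Gamma> r [\<alpha>]"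
          by (metis One_nat_def lessI list_update_code(2))
      qed
      finally show ?thesis .
    qed
    show ?thesis
      using same True
        transfer[of "\<lambda>\<alpha>. (x ! 0, \<alpha>) \<in> parcs \<Gamma>" "\<lambda>\<beta>. (y ! 0, \<beta>) \<in> parcs \<Delta>", OF arcs(1)]
        transfer[of "\<lambda>\<alpha>. (\<alpha>, x ! 0) \<in> parcs \<Gamma>" "\<lambda>\<beta>. (\<beta>, y ! 0) \<in> parcs \<Delta>", OF arcs(2)]
      by (simp add: refine_def)
  qed
qed

text \<open>Tuples are matched from the last entry to the first; the bijection used for a new head
  depends on the tail already matched.\<close>

lemma tuples_bij:
  assumes "l \<le> m"
  shows "\<exists>\<Phi>. bij_betw \<Phi> (tuples l \<Gamma>) (tuples l \<Delta>) \<and> (\<forall>x\<in>tuples l \<Gamma>. Q x (\<Phi> x))"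
  using assms
proof (induction l)
  case 0
  then show ?case
    by (intro exI[of _ "\<lambda>x. x"]) (auto simp: tuples_def nil bij_betw_def)
next
  case (Suc l)
  then obtain \<Phi> where \<Phi>: "bij_betw \<Phi> (tuples l \<Gamma>) (tuples l \<Delta>)"
    and Q\<Phi>: "\<And>x. x \<in> tuples l \<Gamma> \<Longrightarrow> Q x (\<Phi> x)" by auto
  have "\<forall>x\<in>tuples l \<Gamma>. \<exists>\<phi>. bij_betw \<phi> (pverts \<Gamma>) (pverts \<Delta>) \<and>
      (\<forall>\<alpha>\<in>pverts \<Gamma>. Q (\<alpha> # x) (\<phi> \<alpha> # \<Phi> x))"
    using Q\<Phi> Suc.prems bij_betw_apply[OF \<Phi>] by (intro ballI extend) (auto simp: tuples_def)
  then obtain \<phi> where \<phi>: "\<And>x. x \<in> tuples l \<Gamma> \<Longrightarrow> bij_betw (\<phi> x) (pverts \<Gamma>) (pverts \<Delta>)"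
    and Q\<phi>: "\<And>x \<alpha>. x \<in> tuples l \<Gamma> \<Longrightarrow> \<alpha> \<in> pverts \<Gamma> \<Longrightarrow> Q (\<alpha> # x) (\<phi> x \<alpha> # \<Phi> x)"
    by (metis (no_types, lifting))
  define \<Psi> where "\<Psi> z = \<phi> (tl z) (hd z) # \<Phi> (tl z)" for z
  have "inj_on \<Psi> (tuples (Suc l) \<Gamma>)"
    using \<Phi> \<phi> by (auto simp: inj_on_def tuples_Suc \<Psi>_def bij_betw_def)
  moreover have "\<Psi> ` tuples (Suc l) \<Gamma> = tuples (Suc l) \<Delta>"
  proof
    show "\<Psi> ` tuples (Suc l) \<Gamma> \<subseteq> tuples (Suc l) \<Delta>"
      using bij_betw_apply[OF \<Phi>] bij_betw_apply[OF \<phi>] by (auto simp: tuples_Suc \<Psi>_def)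
    show "tuples (Suc l) \<Delta> \<subseteq> \<Psi> ` tuples (Suc l) \<Gamma>"
    proof
      fix z assume "z \<in> tuples (Suc l) \<Delta>"
      then obtain \<beta> y where z: "z = \<beta> # y" "\<beta> \<in> pverts \<Delta>" "y \<in> tuples l \<Delta>"
        by (auto simp: tuples_Suc)
      obtain x where x: "x \<in> tuples l \<Gamma>" "y = \<Phi> x" using \<Phi> z(3) by (auto simp: bij_betw_def)
      obtain \<alpha> where "\<alpha> \<in> pverts \<Gamma>" "\<beta> = \<phi> x \<alpha>" using \<phi>[OF x(1)] z(2) by (auto simp: bij_betw_def)
      with x z show "z \<in> \<Psi> ` tuples (Suc l) \<Gamma>"
        by (auto simp: tuples_Suc \<Psi>_def image_iff)
    qed
  qed
  ultimately have "bij_betw \<Psi> (tuples (Suc l) \<Gamma>) (tuples (Suc l) \<Delta>)"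
    by (simp add: bij_betw_def)
  moreover have "\<forall>z\<in>tuples (Suc l) \<Gamma>. Q z (\<Psi> z)"
    using Q\<phi> by (auto simp: tuples_Suc \<Psi>_def)
  ultimately show ?case by blast
qed

lemma wl_equivalent: "wl_equivalent m \<Gamma> \<Delta>"
proof -
  obtain \<Phi> where \<Phi>: "bij_betw \<Phi> (tuples m \<Gamma>) (tuples m \<Delta>)"
    and Q\<Phi>: "\<And>x. x \<in> tuples m \<Gamma> \<Longrightarrow> Q x (\<Phi> x)"
    using tuples_bij[of m] by auto
  show ?thesis
    unfolding wl_equivalent_def
  proof
    fix k
    let ?r = "wl_rounds m \<Gamma> \<Delta>"
    have "bij_betw \<Phi> {x \<in> tuples m \<Gamma>. wl_colour m \<Gamma> ?r x = k}
        {y \<in> tuples m \<Delta>. wl_colour m \<Delta> ?r y = k}"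
      using \<Phi> colour_eq[OF Q\<Phi> _ bij_betw_apply[OF \<Phi>]]
      by (intro bij_betw_Collect) auto
    then show "card {x \<in> tuples m \<Gamma>. wl_colour m \<Gamma> ?r x = k} =
        card {y \<in> tuples m \<Delta>. wl_colour m \<Delta> ?r y = k}"
      by (rule bij_betw_same_card)
  qed
qed

end

section \<open>The Weisfeiler-Leman dimension is attained\<close>

text \<open>A colour is a formal term that contains the colours of the same tuple in all earlier
  rounds.\<close>

lemma wl_colour_imp_atomic:
  "wl_colour m \<Gamma> r x = wl_colour m \<Delta> r y \<Longrightarrow> atomic_colour m \<Gamma> x = atomic_colour m \<Delta> y"
  by (induction r) (auto simp: refine_def split: if_splits)

lemma digraph_isoI:
  assumes "pair_wf_digraph G" "pair_wf_digraph H" "bij_betw f (pverts G) (pverts H)"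
    and "\<And>x y. x \<in> pverts G \<Longrightarrow> y \<in> pverts G \<Longrightarrow> (x, y) \<in> parcs G \<longleftrightarrow> (f x, f y) \<in> parcs H"
  shows "digraph_iso (with_proj G) (with_proj H)"
proof -
  interpret G: pair_wf_digraph G by fact
  interpret H: pair_wf_digraph H by fact
  let ?h = "\<lparr>iso_verts = f, iso_arcs = map_prod f f, iso_head = snd, iso_tail = fst\<rparr>"
  have inj: "inj_on f (pverts G)" and img: "f ` pverts G = pverts H"
    using assms(3) by (auto simp: bij_betw_def)
  have sub: "parcs G \<subseteq> pverts G \<times> pverts G" "parcs H \<subseteq> pverts H \<times> pverts H"
    using G.in_arcsD1 G.in_arcsD2 H.in_arcsD1 H.in_arcsD2 by auto
  have arcs: "map_prod f f ` parcs G = parcs H"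
  proof (intro equalityI subsetI)
    fix e assume "e \<in> map_prod f f ` parcs G"
    then show "e \<in> parcs H" using assms(4) sub(1) by auto
  next
    fix e assume e: "e \<in> parcs H"
    then obtain x y where "x \<in> pverts G" "y \<in> pverts G" "e = (f x, f y)"
      using sub(2) img by (cases e) blast
    with e show "e \<in> map_prod f f ` parcs G" using assms(4) by force
  qed
  have inj_arcs: "inj_on (map_prod f f) (parcs G)"
    using inj_on_subset[OF map_prod_inj_on[OF inj inj] sub(1)] .
  have "pre_digraph.digraph_isomorphism (with_proj G) ?h"
    unfolding pre_digraph.digraph_isomorphism_def using inj inj_arcs G.wf_digraph_axioms
    by simp
  moreover have "with_proj H = app_iso ?h (with_proj G)"
    using img arcs by (simp add: app_iso_def with_proj_def)
  ultimately show ?thesis unfolding digraph_iso_def by blast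
qed

text \<open>\<open>with_proj\<close> forces tail and head to be the projections, so the arc map of
  an isomorphism is induced by its vertex map.\<close>

lemma digraph_isoD:
  assumes "digraph_iso (with_proj G) (with_proj H)" "pair_wf_digraph G"
  obtains f where "bij_betw f (pverts G) (pverts H)"
    "\<And>x y. x \<in> pverts G \<Longrightarrow> y \<in> pverts G \<Longrightarrow> (x, y) \<in> parcs G \<longleftrightarrow> (f x, f y) \<in> parcs H"
proof -
  interpret G: pair_wf_digraph G by fact
  obtain h where h: "pre_digraph.digraph_isomorphism (with_proj G) h"
      "with_proj H = app_iso h (with_proj G)"
    using assms(1) unfolding digraph_iso_def by blast
  let ?f = "iso_verts h"
  have img: "pverts H = ?f ` pverts G" "parcs H = iso_arcs h ` parcs G"
      "iso_tail h = fst" "iso_head h = snd"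
    using h(2) by (simp_all add: with_proj_def app_iso_def)
  have inj: "inj_on ?f (pverts G)"
    and ends: "\<And>a. a \<in> parcs G \<Longrightarrow> ?f (fst a) = fst (iso_arcs h a) \<and> ?f (snd a) = snd (iso_arcs h a)"
    using h(1) img(3,4) by (auto simp: pre_digraph.digraph_isomorphism_def)
  have arcs: "iso_arcs h a = (?f (fst a), ?f (snd a))" if "a \<in> parcs G" for a
    using ends[OF that] by (auto simp: prod_eq_iff)
  show ?thesis
  proof
    show "bij_betw ?f (pverts G) (pverts H)" using inj img by (simp add: bij_betw_def)
    fix x y assume xy: "x \<in> pverts G" "y \<in> pverts G"
    show "(x, y) \<in> parcs G \<longleftrightarrow> (?f x, ?f y) \<in> parcs H"
    proof
      assume "(x, y) \<in> parcs G"
      then show "(?f x, ?f y) \<in> parcs H"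
        using arcs[of "(x, y)"] img(2) by (metis fst_conv imageI snd_conv)
    next
      assume "(?f x, ?f y) \<in> parcs H"
      then obtain a where a: "a \<in> parcs G" "?f (fst a) = ?f x" "?f (snd a) = ?f y"
        unfolding img(2) using arcs by fastforce
      then have "fst a = x" "snd a = y"
        using inj xy G.in_arcsD1[of "fst a" "snd a"] G.in_arcsD2[of "fst a" "snd a"]
        by (auto simp: inj_on_def)
      with a(1) show "(x, y) \<in> parcs G" by (metis prod.collapse)
    qed
  qed
qed

lemma sum_card_fibres:
  assumes "finite A" "finite C" "c ` A \<subseteq> C"
  shows "card A = (\<Sum>k\<in>C. card {x \<in> A. c x = k})"
  using sum.group[OF assms(1,2), of c "\<lambda>_. 1 :: nat"] assms(3) by simp

text \<open>The atomic colour of a tuple listing all vertices of \<open>\<Delta>\<close> amounts to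
  an adjacency matrix. A tuple of the same colour in \<open>\<Gamma>\<close> yields an injection
  respecting arcs, which is bijective because the vertex numbers agree.\<close>

lemma wl_equivalent_imp_iso:
  assumes "pair_fin_digraph \<Gamma>" "pair_fin_digraph \<Delta>" "wl_equivalent m \<Gamma> \<Delta>"
    and "0 < m" "card (pverts \<Gamma>) \<le> m"
  shows "digraph_iso (with_proj \<Delta>) (with_proj \<Gamma>)"
proof -
  interpret G: pair_fin_digraph \<Gamma> by fact
  interpret D: pair_fin_digraph \<Delta> by fact
  let ?r = "wl_rounds m \<Gamma> \<Delta>"
  let ?cG = "wl_colour m \<Gamma> ?r" and ?cD = "wl_colour m \<Delta> ?r"
  have eqv: "card {x \<in> tuples m \<Gamma>. ?cG x = k} = card {x \<in> tuples m \<Delta>. ?cD x = k}" for k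
    using assms(3) by (auto simp: wl_equivalent_def)
  have fin: "finite (tuples m \<Gamma>)" "finite (tuples m \<Delta>)"
    by (simp_all add: finite_tuples)
  have card_tuples: "card (tuples m A) = card (pverts A) ^ m" if "finite (pverts A)" for A :: "'a pair_pre_digraph"
    using card_lists_length_eq[OF that, of m] by (simp add: tuples_def conj_commute)
  let ?C = "?cG ` tuples m \<Gamma> \<union> ?cD ` tuples m \<Delta>"
  have "card (tuples m \<Gamma>) = card (tuples m \<Delta>)"
    using sum_card_fibres[OF fin(1), of ?C ?cG] sum_card_fibres[OF fin(2), of ?C ?cD] fin eqv by simp
  \<comment> \<open>Both graphs have equally many \<open>m\<close>-tuples, and \<open>n ^ m\<close>
    determines \<open>n\<close> for positive \<open>m\<close>.\<close>
  then have cards: "card (pverts \<Gamma>) = card (pverts \<Delta>)"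
    using card_tuples assms(4) by (simp add: power_eq_iff_eq_base)
  show ?thesis
  proof (cases "pverts \<Gamma> = {}")
    case True
    then have "pverts \<Delta> = {}" using cards by simp
    then show ?thesis using True
      by (intro digraph_isoI[of _ _ id]) (auto intro: G.pair_wf_digraph_axioms D.pair_wf_digraph_axioms)
  next
    case False
    obtain xs where xs: "set xs = pverts \<Delta>" "length xs = card (pverts \<Delta>)"
      using finite_distinct_list[OF D.finite_verts] distinct_card by fastforce
    have "xs \<noteq> []" using xs cards False by auto
    \<comment> \<open>Padding by a repeated vertex brings the list to length \<open>m\<close>; this
      needs a vertex, whence the separate case of the empty graph.\<close>
    define x where "x = xs @ replicate (m - length xs) (hd xs)"
    have x: "length x = m" "set x = pverts \<Delta>"
    proof -
      show "length x = m" using xs(2) cards assms(5) by (simp add: x_def)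
      have "set x = set xs"
        using hd_in_set[OF \<open>xs \<noteq> []\<close>] by (auto simp: x_def simp del: hd_in_set)
      then show "set x = pverts \<Delta>" using xs(1) by simp
    qed
    then have "x \<in> tuples m \<Delta>" by (simp add: tuples_def)
    then have "card {z \<in> tuples m \<Delta>. ?cD z = ?cD x} \<noteq> 0"
      using fin(2) by auto
    then have "{z \<in> tuples m \<Gamma>. ?cG z = ?cD x} \<noteq> {}"
      using eqv[of "?cD x"] by fastforce
    then obtain y where y: "length y = m" "set y \<subseteq> pverts \<Gamma>" "?cG y = ?cD x"
      by (auto simp: tuples_def)
    have "atomic_colour m \<Delta> x = atomic_colour m \<Gamma> y"
      using wl_colour_imp_atomic y(3) by metis
    then have same: "{(i, j). i < m \<and> j < m \<and> x ! i = x ! j} = {(i, j). i < m \<and> j < m \<and> y ! i = y ! j}"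
      "{(i, j). i < m \<and> j < m \<and> (x ! i, x ! j) \<in> parcs \<Delta>} =
       {(i, j). i < m \<and> j < m \<and> (y ! i, y ! j) \<in> parcs \<Gamma>}"
      by (simp_all only: atomic_colour_def colour.inject)
    have at_eq: "x ! i = x ! j \<longleftrightarrow> y ! i = y ! j" if "i < m" "j < m" for i j
      using arg_cong[OF same(1), of "\<lambda>S. (i, j) \<in> S"] that by simp
    have at_arc: "(x ! i, x ! j) \<in> parcs \<Delta> \<longleftrightarrow> (y ! i, y ! j) \<in> parcs \<Gamma>" if "i < m" "j < m" for i j
      using arg_cong[OF same(2), of "\<lambda>S. (i, j) \<in> S"] that by simp
    define ix where "ix v = (SOME i. i < m \<and> x ! i = v)" for v
    have ix: "ix v < m \<and> x ! ix v = v" if "v \<in> pverts \<Delta>" for v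
      unfolding ix_def
    proof (rule someI_ex)
      show "\<exists>i. i < m \<and> x ! i = v" using that x in_set_conv_nth[of v x] by metis
    qed
    define f where "f v = y ! ix v" for v
    have "inj_on f (pverts \<Delta>)"
    proof (rule inj_onI)
      fix u v assume uv: "u \<in> pverts \<Delta>" "v \<in> pverts \<Delta>" "f u = f v"
      then have "x ! ix u = x ! ix v" using at_eq[of "ix u" "ix v"] ix by (simp add: f_def)
      then show "u = v" using ix[OF uv(1)] ix[OF uv(2)] by simp
    qed
    moreover have "f ` pverts \<Delta> \<subseteq> pverts \<Gamma>"
      using ix y by (auto simp: f_def)
    ultimately have "bij_betw f (pverts \<Delta>) (pverts \<Gamma>)"
      unfolding bij_betw_def using cards card_image[of f "pverts \<Delta>"]
        card_subset_eq[of "pverts \<Gamma>" "f ` pverts \<Delta>"] G.finite_verts by simp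
    moreover have "(u, v) \<in> parcs \<Delta> \<longleftrightarrow> (f u, f v) \<in> parcs \<Gamma>"
      if "u \<in> pverts \<Delta>" "v \<in> pverts \<Delta>" for u v
      using at_arc[of "ix u" "ix v"] ix[OF that(1)] ix[OF that(2)] by (simp add: f_def)
    ultimately show ?thesis
      by (intro digraph_isoI) (auto intro: G.pair_wf_digraph_axioms D.pair_wf_digraph_axioms)
  qed
qed

text \<open>An unattained \<open>LEAST\<close> would have an unspecified value, so a witness comes
  first: \<open>Suc (card (pverts \<Gamma>))\<close>. Then the least value itself identifies
  \<open>\<Gamma>\<close> and cannot be below \<open>M\<close>.\<close>

lemma wl_dimension_geI:
  assumes "pair_fin_digraph \<Gamma>"
    and "\<And>m. 0 < m \<Longrightarrow> m < M \<Longrightarrow>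
      \<exists>\<Delta>. pair_fin_digraph \<Delta> \<and> wl_equivalent m \<Gamma> \<Delta> \<and> \<not> digraph_iso (with_proj \<Delta>) (with_proj \<Gamma>)"
  shows "M \<le> wl_dimension \<Gamma>"
proof -
  let ?P = "\<lambda>m. 0 < m \<and> (\<forall>\<Delta>. pair_fin_digraph \<Delta> \<and> wl_equivalent m \<Gamma> \<Delta> \<longrightarrow>
      digraph_iso (with_proj \<Delta>) (with_proj \<Gamma>))"
  have "?P (Suc (card (pverts \<Gamma>)))"
    by (intro conjI allI impI wl_equivalent_imp_iso[OF assms(1)]) auto
  then have "?P (wl_dimension \<Gamma>)"
    unfolding wl_dimension_def by (rule LeastI)
  then have pos: "0 < wl_dimension \<Gamma>"
    and iso: "\<And>\<Delta>. pair_fin_digraph \<Delta> \<Longrightarrow> wl_equivalent (wl_dimension \<Gamma>) \<Gamma> \<Delta> \<Longrightarrow>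
      digraph_iso (with_proj \<Delta>) (with_proj \<Gamma>)" by blast+
  show ?thesis
  proof (rule ccontr)
    assume "\<not> M \<le> wl_dimension \<Gamma>"
    with assms(2)[OF pos] iso show False by auto
  qed
qed

section \<open>Valuations and signed congruences\<close>

lemma int_chinese_remainder:
  fixes m u :: "nat \<Rightarrow> int"
  assumes "\<And>i j. i < l \<Longrightarrow> j < l \<Longrightarrow> i \<noteq> j \<Longrightarrow> coprime (m i) (m j)"
  shows "\<exists>z. \<forall>i<l. m i dvd z - u i"
  using assms
proof (induction l)
  case (Suc l)
  then obtain z where z: "\<And>i. i < l \<Longrightarrow> m i dvd z - u i" by (metis less_Suc_eq)
  have "coprime (\<Prod>i<l. m i) (m l)"
    using Suc.prems by (intro prod_coprime_left) auto
  then obtain y where y: "[y = z] (mod (\<Prod>i<l. m i))" "[y = u l] (mod (m l))"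
    using binary_chinese_remainder_int by blast
  have "m i dvd y - u i" if "i < Suc l" for i
  proof (cases "i = l")
    case True
    then show ?thesis using y(2) by (simp add: cong_iff_dvd_diff)
  next
    case False
    then have i: "i < l" using that by simp
    have "m i dvd (\<Prod>i<l. m i)" using i by (intro dvd_prodI) auto
    then have "m i dvd y - z" using y(1) by (simp add: cong_iff_dvd_diff) (rule dvd_trans)
    from dvd_add[OF this z[OF i]] show ?thesis by simp
  qed
  then show ?case by blast
qed simp

text \<open>\<open>t\<close> realises the largest exponent up to \<open>L\<close> that occurs, and
  smaller powers divide larger ones. The bound \<open>L\<close> keeps the set of exponents finite
  even if \<open>x\<close> lies in \<open>X\<close>.\<close>

lemma nearest_exists:
  fixes p x :: int
  assumes "finite X" "X \<noteq> {}"
  shows "\<exists>t\<in>X. \<forall>u\<in>X. \<forall>a\<le>L. p ^ a dvd x - u \<longrightarrow> p ^ a dvd x - t"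
proof -
  let ?S = "{a. a \<le> L \<and> (\<exists>u\<in>X. p ^ a dvd x - u)}"
  have S: "finite ?S" "?S \<noteq> {}" using assms(2) by (auto intro!: exI[of _ "0::nat"])
  from Max_in[OF S] obtain t where t: "t \<in> X" "p ^ Max ?S dvd x - t" by auto
  have "p ^ a dvd x - t" if "u \<in> X" "a \<le> L" "p ^ a dvd x - u" for u a
  proof -
    have "a \<le> Max ?S" using that by (intro Max_ge[OF S(1)]) blast
    then show ?thesis using dvd_trans[OF le_imp_power_dvd t(2)] by blast
  qed
  with t(1) show ?thesis by blast
qed

definition exact_levels :: "int \<Rightarrow> int set \<Rightarrow> nat set" where
  "exact_levels p X = {a. \<exists>x\<in>X. \<exists>y\<in>X. p ^ a dvd x - y \<and> \<not> p ^ Suc a dvd x - y}"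

text \<open>
  The \<open>p\<close>-adic distance is an ultrametric, so a new point \<open>x\<close> adds at most one value to the set of
  distances, namely its distance to a nearest old point.
\<close>

lemma card_exact_levels:
  fixes p :: int
  assumes "finite X" "X \<noteq> {}"
  shows "card (exact_levels p X \<inter> {..L}) < card X"
  using assms
proof (induction rule: finite_ne_induct)
  case (singleton x)
  then show ?case by (simp add: exact_levels_def)
next
  case (insert x X)
  \<comment> \<open>The bound is \<open>Suc L\<close> because exactness at a level
    \<open>a \<le> L\<close> also tests the exponent \<open>Suc a\<close>.\<close>
  obtain t where t: "t \<in> X" "\<And>u a. u \<in> X \<Longrightarrow> a \<le> Suc L \<Longrightarrow> p ^ a dvd x - u \<Longrightarrow> p ^ a dvd x - t"
    using nearest_exists[OF insert(1,2), of "Suc L" p x] by blast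
  let ?T = "{a. a \<le> L \<and> p ^ a dvd x - t \<and> \<not> p ^ Suc a dvd x - t}"
  have level_t: "?T \<subseteq> {a. a = (THE a. a \<in> ?T)}"
  proof -
    have "a = b" if "a \<in> ?T" "b \<in> ?T" for a b
    proof (rule ccontr)
      assume "a \<noteq> b"
      then have "Suc a \<le> b \<or> Suc b \<le> a" by auto
      then show False using that le_imp_power_dvd dvd_trans by blast
    qed
    then show ?thesis by (blast intro: the_equality[symmetric])
  qed
  have new: "a \<in> exact_levels p X \<or> a \<in> ?T"
    if u: "u \<in> X" "p ^ a dvd x - u" "\<not> p ^ Suc a dvd x - u" "a \<le> L" for u a
  proof (cases "p ^ Suc a dvd x - t")
    case True
    then have "p ^ a dvd x - t" by (metis dvd_mult_right power_Suc)
    with u(2) have "p ^ a dvd t - u" using dvd_diff[of "p ^ a" "x - u" "x - t"] by simp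
    moreover have "\<not> p ^ Suc a dvd t - u"
      using u(3) True dvd_add[of "p ^ Suc a" "x - t" "t - u"] by auto
    ultimately show ?thesis using u t(1) by (auto simp: exact_levels_def)
  next
    case False
    then show ?thesis using t(2)[OF u(1) _ u(2)] u(4) by simp
  qed
  have "exact_levels p (insert x X) \<inter> {..L} \<subseteq> (exact_levels p X \<inter> {..L}) \<union> ?T"
  proof
    fix a assume "a \<in> exact_levels p (insert x X) \<inter> {..L}"
    then obtain y z where "y \<in> insert x X" "z \<in> insert x X" "p ^ a dvd y - z"
      "\<not> p ^ Suc a dvd y - z" and a: "a \<le> L"
      by (auto simp: exact_levels_def)
    then consider "y \<in> X" "z \<in> X" | "z \<in> X" "y = x" | "y \<in> X" "z = x" by auto
    then show "a \<in> (exact_levels p X \<inter> {..L}) \<union> ?T"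
    proof cases
      case 1
      then show ?thesis using \<open>p ^ a dvd y - z\<close> \<open>\<not> p ^ Suc a dvd y - z\<close> a
        unfolding exact_levels_def by blast
    next
      case 2
      then show ?thesis using new[OF 2(1) _ _ a] \<open>p ^ a dvd y - z\<close> \<open>\<not> p ^ Suc a dvd y - z\<close> a by blast
    next
      case 3
      then have "p ^ a dvd x - y" "\<not> p ^ Suc a dvd x - y"
        using \<open>p ^ a dvd y - z\<close> \<open>\<not> p ^ Suc a dvd y - z\<close> by (simp_all add: dvd_diff_commute)
      then show ?thesis using new[OF 3(1) _ _ a] a by blast
    qed
  qed
  then have "card (exact_levels p (insert x X) \<inter> {..L}) \<le>
      card ((exact_levels p X \<inter> {..L}) \<union> {a. a = (THE a. a \<in> ?T)})"
    using level_t by (intro card_mono) auto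
  also have "\<dots> \<le> card (exact_levels p X \<inter> {..L}) + 1"
    by (rule order_trans[OF card_Un_le]) simp
  also have "\<dots> < card (insert x X)" using insert by simp
  finally show ?case .
qed

section \<open>Four chains of prime powers and the ambient modulus\<close>

definition chain_prime :: "nat \<Rightarrow> int" where
  "chain_prime c = (if c = 0 then 3 else if c = 1 then 5 else if c = 2 then 7 else 11)"

lemma chain_prime_pos: "0 < chain_prime c"
  by (simp add: chain_prime_def)

lemma odd_chain_prime: "odd (chain_prime c)"
  by (simp add: chain_prime_def)

lemma coprime_chain_prime: "c < 4 \<Longrightarrow> d < 4 \<Longrightarrow> c \<noteq> d \<Longrightarrow> coprime (chain_prime c) (chain_prime d)"
proof -
  have "coprime (3::int) 5" "coprime (3::int) 7" "coprime (3::int) 11" "coprime (5::int) 7"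
    "coprime (5::int) 11" "coprime (7::int) 11"
    by (simp_all add: coprime_iff_gcd_eq_1 gcd_red_int[of _ "numeral _"] gcd_non_0_int)
  moreover assume "c < 4" "d < 4" "c \<noteq> d"
  ultimately show ?thesis
    by (auto simp: chain_prime_def coprime_commute)
qed

abbreviation sign_valued :: "('a \<Rightarrow> int) \<Rightarrow> bool" where
  "sign_valued s \<equiv> \<forall>e. s e = 1 \<or> s e = -1"

lemma dvd_sign_mult:
  assumes "sign_valued s" shows "(m::int) dvd s e * d \<longleftrightarrow> m dvd d"
  using assms[rule_format, of e] by auto

locale chains =
  fixes K :: nat
begin

text \<open>\<open>K\<close> is the top level. The exponent \<open>K + 6\<close> makes
  \<open>q\<close> exceed twice the number \<open>5 * K + 6\<close> of labels used later; the
  exponent \<open>Suc K\<close> in \<open>g\<close> keeps differences of exact level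
  \<open>K\<close> distinct from 0.\<close>

definition q :: int where "q = 2 ^ (K + 6)"
definition g :: int where "g = (\<Prod>c<4. chain_prime c ^ Suc K)"

lemma q_pos: "0 < q" by (simp add: q_def)
lemma g_pos: "0 < g" by (simp add: g_def prod_pos chain_prime_pos)

lemma coprime_q: "coprime q (chain_prime c ^ a)"
  using odd_chain_prime[of c] by (simp add: q_def)

lemma coprime_q_g: "coprime q g"
  unfolding g_def by (intro prod_coprime_right coprime_q)

lemma chain_dvd_g:
  assumes "c < 4" "a \<le> Suc K"
  shows "chain_prime c ^ a dvd g"
proof -
  have "chain_prime c ^ Suc K dvd g"
    unfolding g_def using assms(1) by (intro dvd_prodI) auto
  with assms(2) show ?thesis by (meson dvd_trans le_imp_power_dvd)
qed

lemma g_dvdI: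
  assumes "\<And>c. c < 4 \<Longrightarrow> chain_prime c ^ Suc K dvd d"
  shows "g dvd d"
proof -
  have "(\<Prod>c<l. chain_prime c ^ Suc K) dvd d" if "l \<le> 4" for l
    using that
  proof (induction l)
    case (Suc l)
    have "coprime (\<Prod>c<l. chain_prime c ^ Suc K) (chain_prime l ^ Suc K)"
      using Suc.prems by (intro prod_coprime_left coprime_power_left_iff[THEN iffD2] coprime_power_right_iff[THEN iffD2] disjI1 coprime_chain_prime) auto
    then have "(\<Prod>c<l. chain_prime c ^ Suc K) * chain_prime l ^ Suc K dvd d"
      using Suc assms by (intro divides_mult) auto
    then show ?case by simp
  qed simp
  then show ?thesis unfolding g_def by simp
qed

lemma qg_dvdI:
  assumes "q dvd d" "\<And>c. c < 4 \<Longrightarrow> chain_prime c ^ Suc K dvd d"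
  shows "q * g dvd d"
  using assms g_dvdI coprime_q_g by (intro divides_mult) auto

lemma residues_exist:
  "\<exists>z. q dvd z - w \<and> (\<forall>c<4. chain_prime c ^ Suc K dvd z - r c)"
proof -
  \<comment> \<open>Index 4 stands for the modulus \<open>q\<close>, the smaller indices for the
    chains.\<close>
  let ?m = "\<lambda>i. if i < 4 then chain_prime i ^ Suc K else q"
  let ?u = "\<lambda>i. if i < 4 then r i else w"
  have "coprime (?m i) (?m j)" if "i < 5" "j < 5" "i \<noteq> j" for i j
  proof -
    have "i < 4 \<or> i = 4" "j < 4 \<or> j = 4" using that by auto
    then show ?thesis
      using that coprime_chain_prime[of i j] coprime_q[of j "Suc K"] coprime_q[of i "Suc K"]
      by (auto simp del: power_Suc simp: coprime_commute)
  qed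
  then obtain z where z: "\<And>i. i < 5 \<Longrightarrow> ?m i dvd z - ?u i"
    using int_chinese_remainder[of 5 ?m ?u] by blast
  show ?thesis
  proof (intro exI conjI allI impI)
    show "q dvd z - w" using z[of 4] by simp
    show "chain_prime c ^ Suc K dvd z - r c" if "c < 4" for c using z[of c] that by (simp del: power_Suc)
  qed
qed

text \<open>For signs \<open>s\<close>: \<open>d'\<close> agrees with \<open>d\<close> modulo
  \<open>q\<close>, has the same valuations, and its leading digit at exact level \<open>a\<close>
  of chain \<open>c\<close> is that of \<open>d\<close> times \<open>s (c, a)\<close>. Below the
  exact level the condition only says that the next power divides \<open>d'\<close>.\<close>

definition sim :: "(nat \<times> nat \<Rightarrow> int) \<Rightarrow> int \<Rightarrow> int \<Rightarrow> bool" where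
  "sim s d d' \<longleftrightarrow> q dvd d' - d \<and>
     (\<forall>c<4. \<forall>a\<le>K. chain_prime c ^ a dvd d \<longrightarrow> chain_prime c ^ Suc a dvd d' - s (c, a) * d)"

text \<open>The levels whose signs are visible in differences of points of \<open>X\<close>; the
  duplicator must keep these signs.\<close>

definition pinned :: "int set \<Rightarrow> (nat \<times> nat) set" where
  "pinned X = {(c, a). c < 4 \<and> a \<le> K \<and> a \<in> exact_levels (chain_prime c) X}"

lemma pinned_mono: "X \<subseteq> Y \<Longrightarrow> pinned X \<subseteq> pinned Y"
  by (fastforce simp: pinned_def exact_levels_def)

lemma card_pinned:
  assumes "finite X" "X \<noteq> {}"
  shows "finite {a. (c, a) \<in> pinned X}" "card {a. (c, a) \<in> pinned X} < card X"
proof -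
  have sub: "{a. (c, a) \<in> pinned X} \<subseteq> exact_levels (chain_prime c) X \<inter> {..K}"
    by (auto simp: pinned_def)
  then show "finite {a. (c, a) \<in> pinned X}" by (rule finite_subset) simp
  have "card {a. (c, a) \<in> pinned X} \<le> card (exact_levels (chain_prime c) X \<inter> {..K})"
    by (rule card_mono[OF _ sub]) simp
  then show "card {a. (c, a) \<in> pinned X} < card X"
    using card_exact_levels[OF assms, of "chain_prime c" K] by linarith
qed

text \<open>One exponent at a time: a sign is a unit, so the congruence modulo the next power
  transfers divisibility by that power.\<close>

lemma sim_dvd_iff:
  assumes "sim s d d'" "sign_valued s" "c < 4" "a \<le> Suc K"
  shows "chain_prime c ^ a dvd d \<longleftrightarrow> chain_prime c ^ a dvd d'"
  using assms(4)
proof (induction a)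
  case (Suc a)
  let ?p = "chain_prime c"
  have *: "?p ^ Suc a dvd d' - s (c, a) * d" if "?p ^ a dvd d"
    using assms(1,3) Suc.prems that by (auto simp: sim_def)
  have "?p ^ Suc a dvd d \<longleftrightarrow> ?p ^ Suc a dvd d'" if d: "?p ^ a dvd d"
  proof -
    have "?p ^ Suc a dvd d' \<longleftrightarrow> ?p ^ Suc a dvd s (c, a) * d"
      using dvd_add_right_iff[OF *[OF d], of "s (c, a) * d"] by simp
    then show ?thesis using dvd_sign_mult[OF assms(2)] by blast
  qed
  moreover have "?p ^ a dvd x" if "?p ^ Suc a dvd x" for x
    using that by (metis dvd_mult_right power_Suc)
  ultimately show ?case using Suc by (meson Suc_leD)
qed simp

lemma sim_eq_iff:
  assumes "sim s d d'" "sign_valued s"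
  shows "q * g dvd d \<longleftrightarrow> q * g dvd d'"
proof -
  have q: "q dvd d \<longleftrightarrow> q dvd d'"
    using assms(1) dvd_add_right_iff[of q "d' - d" d] by (simp add: sim_def)
  have iff: "q * g dvd x \<longleftrightarrow> q dvd x \<and> (\<forall>c<4. chain_prime c ^ Suc K dvd x)" for x
  proof
    assume *: "q * g dvd x"
    then have "q dvd x" "g dvd x" by (auto elim: dvd_mult_left dvd_mult_right)
    then show "q dvd x \<and> (\<forall>c<4. chain_prime c ^ Suc K dvd x)"
      using chain_dvd_g[OF _ order_refl] dvd_trans by blast
  qed (use qg_dvdI in blast)
  show ?thesis unfolding iff using q sim_dvd_iff[OF assms _ order_refl] by simp
qed

text \<open>Below the exact level of a chain, \<open>d\<close> and \<open>d'\<close> are both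
  divisible by the next power, so any sign satisfies the congruence there.\<close>

lemma sim_change:
  assumes "sim s d d'" "sign_valued s" "sign_valued s'"
    and same: "\<And>c a. c < 4 \<Longrightarrow> a \<le> K \<Longrightarrow> chain_prime c ^ a dvd d \<Longrightarrow> \<not> chain_prime c ^ Suc a dvd d \<Longrightarrow>
      s' (c, a) = s (c, a)"
  shows "sim s' d d'"
  unfolding sim_def
proof (intro conjI allI impI)
  show "q dvd d' - d" using assms(1) by (simp add: sim_def)
  fix c a assume ca: "c < 4" "a \<le> K" "chain_prime c ^ a dvd d"
  show "chain_prime c ^ Suc a dvd d' - s' (c, a) * d"
  proof (cases "chain_prime c ^ Suc a dvd d")
    case True
    then have "chain_prime c ^ Suc a dvd d'" using sim_dvd_iff[OF assms(1,2) ca(1)] ca(2) by blast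
    then show ?thesis using True dvd_sign_mult[OF assms(3)] by (intro dvd_diff) blast+
  next
    case False
    then show ?thesis using same[OF ca(1,2,3)] assms(1) ca by (auto simp: sim_def)
  qed
qed

lemma sim_refl_0: "sim s 0 0"
  by (simp add: sim_def)

lemma sim_minus: "sim s d d' \<Longrightarrow> sim s (- d) (- d')"
proof -
  assume *: "sim s d d'"
  have neg: "m dvd - x - y * - z \<longleftrightarrow> m dvd x - y * z" for m x y z :: int
    using dvd_minus_iff[of m "x - y * z"] by (simp add: algebra_simps)
  show ?thesis using * neg[of _ d' 1 d] by (simp add: sim_def neg del: mult_minus_right power_Suc)
qed

text \<open>
  The image of a new point is prescribed in each chain relative to a nearest old point \<open>x ! t c\<close>,
  by multiplication with the sign of the level \<open>v c\<close> of that difference.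
\<close>

lemma sim_extend:
  assumes s: "sign_valued s"
    and len: "0 < length x"
    and pairs: "\<And>u w. u < length x \<Longrightarrow> w < length x \<Longrightarrow> sim s (x ! u - x ! w) (y ! u - y ! w)"
    and t: "\<And>c. c < 4 \<Longrightarrow> t c < length x"
    and nearest: "\<And>c u a. c < 4 \<Longrightarrow> u < length x \<Longrightarrow> a \<le> Suc K \<Longrightarrow>
      chain_prime c ^ a dvd \<alpha> - x ! u \<Longrightarrow> chain_prime c ^ a dvd \<alpha> - x ! t c"
    and v: "\<And>c a. c < 4 \<Longrightarrow> a \<le> K \<Longrightarrow> chain_prime c ^ a dvd \<alpha> - x ! t c \<Longrightarrow> a \<le> v c"
    and v_dvd: "\<And>c. c < 4 \<Longrightarrow> chain_prime c ^ v c dvd \<alpha> - x ! t c"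
    and vK: "\<And>c. c < 4 \<Longrightarrow> v c \<le> K"
    and zq: "q dvd z - (y ! 0 + (\<alpha> - x ! 0))"
    and zc: "\<And>c. c < 4 \<Longrightarrow> chain_prime c ^ Suc K dvd z - (y ! t c + s (c, v c) * (\<alpha> - x ! t c))"
    and u: "u < length x"
  shows "sim s (\<alpha> - x ! u) (z - y ! u)"
  unfolding sim_def
proof (intro conjI allI impI)
  have "q dvd (y ! 0 - y ! u) - (x ! 0 - x ! u)" using pairs[OF len u] by (simp add: sim_def)
  from dvd_add[OF zq this] show "q dvd z - y ! u - (\<alpha> - x ! u)" by (simp add: algebra_simps)
  fix c a assume ca: "c < 4" "a \<le> K" and dv: "chain_prime c ^ a dvd \<alpha> - x ! u"
  let ?p = "chain_prime c" and ?t = "t c"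
  have dt: "?p ^ a dvd \<alpha> - x ! ?t" using nearest[OF ca(1) u _ dv] ca(2) by simp
  have "?p ^ a dvd x ! ?t - x ! u" using dvd_diff[OF dv dt] by simp
  then have 1: "?p ^ Suc a dvd (y ! ?t - y ! u) - s (c, a) * (x ! ?t - x ! u)"
    using pairs[OF t[OF ca(1)] u] ca by (simp add: sim_def)
  have 2: "?p ^ Suc a dvd z - (y ! ?t + s (c, v c) * (\<alpha> - x ! ?t))"
    using zc[OF ca(1)] ca(2) by (meson Suc_le_mono dvd_trans le_imp_power_dvd)
  \<comment> \<open>The two signs can differ only for \<open>a\<close> below \<open>v c\<close>, and
    there the higher divisibility of \<open>\<alpha> - x ! t c\<close> absorbs the
    difference.\<close>
  have 3: "?p ^ Suc a dvd (s (c, v c) - s (c, a)) * (\<alpha> - x ! ?t)"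
  proof (cases "a = v c")
    case False
    then have "Suc a \<le> v c" using v[OF ca dt] by simp
    then have "?p ^ Suc a dvd \<alpha> - x ! ?t"
      using v_dvd[OF ca(1)] by (meson dvd_trans le_imp_power_dvd)
    then show ?thesis by (rule dvd_mult)
  qed simp
  \<comment> \<open>The difference is routed through the nearest point: an old pair, the
    prescription of \<open>z\<close>, and the change of sign.\<close>
  have "z - y ! u - s (c, a) * (\<alpha> - x ! u) =
      ((y ! ?t - y ! u) - s (c, a) * (x ! ?t - x ! u)) + (z - (y ! ?t + s (c, v c) * (\<alpha> - x ! ?t)))
      + (s (c, v c) - s (c, a)) * (\<alpha> - x ! ?t)"
    by (simp add: algebra_simps)
  then show "?p ^ Suc a dvd z - y ! u - s (c, a) * (\<alpha> - x ! u)"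
    using dvd_add[OF dvd_add[OF 1 2] 3] by presburger
qed

end

section \<open>The grid and its parity constraints\<close>

lemma prod_list_flip:
  assumes "distinct xs" "e \<in> set xs"
  shows "prod_list (map (s(e := - s e)) xs) = - prod_list (map s xs :: int list)"
  using assms
proof (induction xs)
  case (Cons x xs)
  have "map (s(e := - s e)) xs = map s xs" if "e \<notin> set xs"
    using that by simp
  with Cons show ?case by (cases "x = e") (auto simp del: fun_upd_apply simp: fun_upd_same fun_upd_other)
qed simp

lemma prod_list_sign: "sign_valued s \<Longrightarrow> prod_list (map s xs) = 1 \<or> prod_list (map s xs) = -1"
  by (induction xs) auto

lemma prod_list_map_mult:
  "prod_list (map (\<lambda>e. f e * h e :: int) xs) = prod_list (map f xs) * prod_list (map h xs)"
  by (induction xs) (auto simp: ac_simps)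

locale grid =
  fixes k :: nat
  assumes k_ge: "2 \<le> k"
begin

text \<open>
  An edge is named by a chain and a level in that chain. Two chains alternate along each row and two
  along each column, so that the edges at a vertex lie in distinct chains.
\<close>

definition hedge :: "nat \<Rightarrow> nat \<Rightarrow> nat \<times> nat" where
  "hedge i j = (j mod 2, i * k + j)"

definition vedge :: "nat \<Rightarrow> nat \<Rightarrow> nat \<times> nat" where
  "vedge i j = (2 + i mod 2, i * k + j)"

text \<open>\<open>hedge i j\<close> joins (i, j) to (i, j + 1), and \<open>vedge i j\<close> joins
  (i, j) to (i + 1, j). The order is right, left, below, above.\<close>

definition edges :: "nat \<Rightarrow> nat \<Rightarrow> (nat \<times> nat) list" where
  "edges i j =
     (if Suc j < k then [hedge i j] else []) @ (if 0 < j then [hedge i (j - 1)] else []) @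
     (if Suc i < k then [vedge i j] else []) @ (if 0 < i then [vedge (i - 1) j] else [])"

lemma index_inj: "j < k \<Longrightarrow> j' < k \<Longrightarrow> i * k + j = i' * k + j' \<longleftrightarrow> i = i' \<and> j = (j'::nat)"
  by (metis add.commute div_mult_self3 div_less add.right_neutral mod_mult_self3 mod_less
      less_zeroE neq0_conv)

lemma index_less: "i < k \<Longrightarrow> j < k \<Longrightarrow> i * k + j < k * k"
  using mult_le_mono1[of "Suc i" k k] by simp

lemma hedge_eq: "j < k \<Longrightarrow> j' < k \<Longrightarrow> hedge i j = hedge i' j' \<longleftrightarrow> i = i' \<and> j = j'"
  using index_inj by (auto simp: hedge_def)

lemma vedge_eq: "j < k \<Longrightarrow> j' < k \<Longrightarrow> vedge i j = vedge i' j' \<longleftrightarrow> i = i' \<and> j = j'"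
  using index_inj by (auto simp: vedge_def)

lemma hedge_neq_vedge: "hedge i j \<noteq> vedge i' j'" "vedge i' j' \<noteq> hedge i j"
  by (auto simp: hedge_def vedge_def)

lemma edges_nonempty: "edges i j \<noteq> []"
  using k_ge by (auto simp: edges_def)

lemma mod_2_pred: "0 < j \<Longrightarrow> j mod 2 \<noteq> (j - 1) mod (2::nat)"
  by (cases j) (auto simp: mod_Suc)

text \<open>A number has at most one exact level per chain, so the edges at a vertex can all be
  exact levels of one difference only if their chains differ. Consecutive edges on a line differ in
  the parity that selects the chain.\<close>

lemma distinct_chains: "distinct (map fst (edges i j))"
proof -
  have "a mod 2 \<noteq> 2 + b mod 2" "2 + b mod 2 \<noteq> a mod 2" for a b :: nat
    using mod_less_divisor[of 2 a] by linarith+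
  then show ?thesis
    using mod_2_pred[of i] mod_2_pred[of i, symmetric] mod_2_pred[of j]
      \<open>\<And>b a. 2 + b mod 2 \<noteq> a mod 2\<close>[of 0]
    by (auto simp: edges_def hedge_def vedge_def del: One_nat_def)
qed

lemma distinct_edges: "distinct (edges i j)"
  using distinct_chains distinct_map by blast

lemma edges_range:
  assumes "i < k" "j < k" "(c, a) \<in> set (edges i j)"
  shows "c < 4" "a < k * k"
  using assms index_less[of i j] index_less[of i "j - 1"] index_less[of "i - 1" j]
  by (auto simp: edges_def hedge_def vedge_def split: if_splits)

lemma hedge_in_edges:
  assumes "Suc j < k" "j' < k"
  shows "hedge i j \<in> set (edges i' j') \<longleftrightarrow> i' = i \<and> (j' = j \<or> j' = Suc j)"
  using assms hedge_eq[of j j' i i'] hedge_eq[of j "j' - 1" i i']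
  by (auto simp: edges_def hedge_neq_vedge)

lemma vedge_in_edges:
  assumes "Suc i < k" "j < k" "i' < k" "j' < k"
  shows "vedge i j \<in> set (edges i' j') \<longleftrightarrow> j' = j \<and> (i' = i \<or> i' = Suc i)"
  using assms vedge_eq[of j j' i i'] vedge_eq[of j j' i "i' - 1"]
  by (auto simp: edges_def hedge_neq_vedge)

section \<open>Constraints at the vertices and the moving of a violation\<close>

definition twist :: "bool \<Rightarrow> nat \<Rightarrow> nat \<Rightarrow> int" where
  "twist b i j = (if b \<and> i = 0 \<and> j = 0 then -1 else 1)"

lemma twist_sign: "twist b i j = 1 \<or> twist b i j = -1"
  by (simp add: twist_def)

text \<open>Such signs turn untwisted gadgets into twisted ones at every vertex but possibly (i, j).
  By \<open>prod_edges\<close> and \<open>prod_twist\<close> no signs meet all constraints, so some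
  vertex has to be exempt.\<close>

definition satisfies_off :: "(nat \<times> nat \<Rightarrow> int) \<Rightarrow> nat \<Rightarrow> nat \<Rightarrow> bool" where
  "satisfies_off s i j \<longleftrightarrow> (\<forall>i'<k. \<forall>j'<k. (i', j') \<noteq> (i, j) \<longrightarrow>
     prod_list (map s (edges i' j')) = twist True i' j')"

text \<open>Flipping \<open>e\<close> repairs the constraint at (i, j) and otherwise affects only
  the one at (i2, j2), which becomes the exempt vertex.\<close>

lemma move_one:
  assumes s: "sign_valued s" "satisfies_off s i j" and ij: "i < k" "j < k"
    and e: "\<And>i' j'. i' < k \<Longrightarrow> j' < k \<Longrightarrow>
      e \<in> set (edges i' j') \<longleftrightarrow> (i', j') = (i, j) \<or> (i', j') = (i2, j2)"
  shows "\<exists>s'. sign_valued s' \<and> satisfies_off s' i2 j2 \<and> (\<forall>f. f \<noteq> e \<longrightarrow> s' f = s f)"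
proof (cases "prod_list (map s (edges i j)) = twist True i j")
  case True
  then have "satisfies_off s i2 j2" using s(2) unfolding satisfies_off_def by (metis prod.inject)
  then show ?thesis using s(1) by blast
next
  case False
  let ?s = "s(e := - s e)"
  have "prod_list (map ?s (edges i j)) = - prod_list (map s (edges i j))"
    using e[OF ij] by (intro prod_list_flip distinct_edges) auto
  also have "\<dots> = twist True i j"
    using False prod_list_sign[OF s(1), of "edges i j"] twist_sign[of True i j] by auto
  finally have here: "prod_list (map ?s (edges i j)) = twist True i j" .
  have "prod_list (map ?s (edges i' j')) = twist True i' j'"
    if "i' < k" "j' < k" "(i', j') \<noteq> (i2, j2)" for i' j'
  proof (cases "(i', j') = (i, j)")
    case True
    then show ?thesis using here by simp
  next
    case False
    then have "e \<notin> set (edges i' j')" using e that by blast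
    then have "map ?s (edges i' j') = map s (edges i' j')" by simp
    then show ?thesis using s(2) that False unfolding satisfies_off_def by metis
  qed
  then have "satisfies_off ?s i2 j2" unfolding satisfies_off_def by blast
  moreover have "sign_valued ?s" using s(1) by auto
  ultimately show ?thesis by (intro exI[of _ ?s]) auto
qed

lemma move_right:
  assumes "sign_valued s" "satisfies_off s i j" "i < k" "Suc j < k"
  shows "\<exists>s'. sign_valued s' \<and> satisfies_off s' i (Suc j) \<and> (\<forall>f. f \<noteq> hedge i j \<longrightarrow> s' f = s f)"
  using assms by (intro move_one[where i = i and j = j]) (auto simp: hedge_in_edges)

lemma move_left:
  assumes "sign_valued s" "satisfies_off s i (Suc j)" "i < k" "Suc j < k"
  shows "\<exists>s'. sign_valued s' \<and> satisfies_off s' i j \<and> (\<forall>f. f \<noteq> hedge i j \<longrightarrow> s' f = s f)"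
  using assms by (intro move_one[where i = i and j = "Suc j"]) (auto simp: hedge_in_edges)

lemma move_down:
  assumes "sign_valued s" "satisfies_off s i j" "Suc i < k" "j < k"
  shows "\<exists>s'. sign_valued s' \<and> satisfies_off s' (Suc i) j \<and> (\<forall>f. f \<noteq> vedge i j \<longrightarrow> s' f = s f)"
  using assms by (intro move_one[where i = i and j = j]) (auto simp: vedge_in_edges)

lemma move_up:
  assumes "sign_valued s" "satisfies_off s (Suc i) j" "Suc i < k" "j < k"
  shows "\<exists>s'. sign_valued s' \<and> satisfies_off s' i j \<and> (\<forall>f. f \<noteq> vedge i j \<longrightarrow> s' f = s f)"
  using assms by (intro move_one[where i = "Suc i" and j = j]) (auto simp: vedge_in_edges)

text \<open>The violation travels left to column 0 and then right to column \<open>j'\<close>, by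
  two one-sided inductions; only horizontal edges of row \<open>i\<close> are flipped.\<close>

lemma move_in_row:
  assumes "sign_valued s" "satisfies_off s i j" "i < k" "j < k" "j' < k"
  shows "\<exists>s'. sign_valued s' \<and> satisfies_off s' i j' \<and> (\<forall>f. (\<forall>l<k. f \<noteq> hedge i l) \<longrightarrow> s' f = s f)"
proof -
  let ?A = "\<lambda>s s'. \<forall>f. (\<forall>l<k. f \<noteq> hedge i l) \<longrightarrow> s' f = (s f :: int)"
  have "\<exists>s'. sign_valued s' \<and> satisfies_off s' i 0 \<and> ?A s s'"
    using assms(1,2,4)
  proof (induction j arbitrary: s)
    case (Suc j)
    obtain s1 where s1: "sign_valued s1" "satisfies_off s1 i j" "\<forall>f. f \<noteq> hedge i j \<longrightarrow> s1 f = s f"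
      using move_left[OF Suc.prems(1,2) assms(3) Suc.prems(3)] by blast
    from Suc.IH[OF s1(1,2)] Suc.prems(3) obtain s2 where
      "sign_valued s2" "satisfies_off s2 i 0" "?A s1 s2" by auto
    then show ?case using s1(3) Suc.prems(3) by (intro exI[of _ s2]) auto
  qed auto
  then obtain s0 where s0: "sign_valued s0" "satisfies_off s0 i 0" "?A s s0" by blast
  have "\<exists>s'. sign_valued s' \<and> satisfies_off s' i j' \<and> ?A s0 s'"
    using assms(5)
  proof (induction j')
    case 0
    then show ?case using s0 by blast
  next
    case (Suc j)
    then obtain s1 where s1: "sign_valued s1" "satisfies_off s1 i j" "?A s0 s1" by auto
    from move_right[OF s1(1,2) assms(3) Suc.prems] obtain s2 where
      "sign_valued s2" "satisfies_off s2 i (Suc j)" "\<forall>f. f \<noteq> hedge i j \<longrightarrow> s2 f = s1 f" by blast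
    then show ?case using s1(3) Suc.prems by (intro exI[of _ s2]) auto
  qed
  then obtain s1 where "sign_valued s1" "satisfies_off s1 i j'" "?A s0 s1" by blast
  then show ?thesis using s0(3) by (intro exI[of _ s1]) auto
qed

lemma move_in_column:
  assumes "sign_valued s" "satisfies_off s i j" "i < k" "j < k" "i' < k"
  shows "\<exists>s'. sign_valued s' \<and> satisfies_off s' i' j \<and> (\<forall>f. (\<forall>l<k. f \<noteq> vedge l j) \<longrightarrow> s' f = s f)"
proof -
  let ?A = "\<lambda>s s'. \<forall>f. (\<forall>l<k. f \<noteq> vedge l j) \<longrightarrow> s' f = (s f :: int)"
  have "\<exists>s'. sign_valued s' \<and> satisfies_off s' 0 j \<and> ?A s s'"
    using assms(1,2,3)
  proof (induction i arbitrary: s)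
    case (Suc i)
    obtain s1 where s1: "sign_valued s1" "satisfies_off s1 i j" "\<forall>f. f \<noteq> vedge i j \<longrightarrow> s1 f = s f"
      using move_up[OF Suc.prems assms(4)] by blast
    from Suc.IH[OF s1(1,2)] Suc.prems(3) obtain s2 where
      "sign_valued s2" "satisfies_off s2 0 j" "?A s1 s2" by auto
    then show ?case using s1(3) Suc.prems(3) by (intro exI[of _ s2]) auto
  qed auto
  then obtain s0 where s0: "sign_valued s0" "satisfies_off s0 0 j" "?A s s0" by blast
  have "\<exists>s'. sign_valued s' \<and> satisfies_off s' i' j \<and> ?A s0 s'"
    using assms(5)
  proof (induction i')
    case 0
    then show ?case using s0 by blast
  next
    case (Suc i)
    then obtain s1 where s1: "sign_valued s1" "satisfies_off s1 i j" "?A s0 s1" by auto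
    from move_down[OF s1(1,2) Suc.prems assms(4)] obtain s2 where
      "sign_valued s2" "satisfies_off s2 (Suc i) j" "\<forall>f. f \<noteq> vedge i j \<longrightarrow> s2 f = s1 f" by blast
    then show ?case using s1(3) Suc.prems by (intro exI[of _ s2]) auto
  qed
  then obtain s1 where "sign_valued s1" "satisfies_off s1 i' j" "?A s0 s1" by blast
  then show ?thesis using s0(3) by (intro exI[of _ s1]) auto
qed

section \<open>Hiding places for the violation\<close>

definition free :: "(nat \<times> nat) set \<Rightarrow> nat \<Rightarrow> nat \<Rightarrow> bool" where
  "free P i j \<longleftrightarrow> i < k \<and> j < k \<and> (\<forall>l<k. hedge i l \<notin> P) \<and> (\<forall>l<k. vedge l j \<notin> P)"

lemma free_mono: "free P i j \<Longrightarrow> P' \<subseteq> P \<Longrightarrow> free P' i j"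
  by (auto simp: free_def)

lemma free_edges: "free P i j \<Longrightarrow> e \<in> set (edges i j) \<Longrightarrow> e \<notin> P"
  by (auto simp: free_def edges_def split: if_splits)

text \<open>The route follows row \<open>i\<close>, which avoids \<open>P\<close> by the old hiding
  place, to column \<open>j'\<close>, and then that column, which avoids \<open>P\<close> by the new
  one.\<close>

lemma move_free:
  assumes "sign_valued s" "satisfies_off s i j" "free P i j" "free P i' j'"
  shows "\<exists>s'. sign_valued s' \<and> satisfies_off s' i' j' \<and> (\<forall>e\<in>P. s' e = s e)"
proof -
  have ij: "i < k" "j < k" "i' < k" "j' < k" using assms(3,4) by (auto simp: free_def)
  obtain s1 where s1: "sign_valued s1" "satisfies_off s1 i j'"
    "\<forall>f. (\<forall>l<k. f \<noteq> hedge i l) \<longrightarrow> s1 f = s f"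
    using move_in_row[OF assms(1,2) ij(1,2,4)] by blast
  obtain s2 where s2: "sign_valued s2" "satisfies_off s2 i' j'"
    "\<forall>f. (\<forall>l<k. f \<noteq> vedge l j') \<longrightarrow> s2 f = s1 f"
    using move_in_column[OF s1(1,2) ij(1,4,3)] by blast
  have "s2 e = s e" if "e \<in> P" for e
  proof -
    have "\<forall>l<k. e \<noteq> hedge i l" "\<forall>l<k. e \<noteq> vedge l j'"
      using that assms(3,4) by (auto simp: free_def)
    then have "s1 e = s e" "s2 e = s1 e" using s1(3) s2(3) by blast+
    then show ?thesis by simp
  qed
  with s2 show ?thesis by blast
qed

text \<open>Quotient and remainder by \<open>k\<close> recover the row of a horizontal and the
  column of a vertical edge from its level. Two chains hold at most \<open>2 * m < k\<close> levels
  of \<open>P\<close>, so chains 0 and 1 miss a row, and chains 2 and 3 miss a column.\<close>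

lemma free_exists:
  assumes "\<And>c. finite {a. (c, a) \<in> P}" "\<And>c. card {a. (c, a) \<in> P} \<le> m" "2 * m < k"
  shows "\<exists>i j. free P i j"
proof -
  have avoid: "\<exists>i<k. \<forall>a. (c, a) \<in> P \<or> (d, a) \<in> P \<longrightarrow> f a \<noteq> i" for f :: "nat \<Rightarrow> nat" and c d
  proof (rule ccontr)
    assume "\<not> ?thesis"
    then have "{..<k} \<subseteq> f ` ({a. (c, a) \<in> P} \<union> {a. (d, a) \<in> P})" by blast
    then have "k \<le> card (f ` ({a. (c, a) \<in> P} \<union> {a. (d, a) \<in> P}))"
      using assms(1) by (metis card_lessThan card_mono finite_UnI finite_imageI)
    also have "\<dots> \<le> card ({a. (c, a) \<in> P} \<union> {a. (d, a) \<in> P})"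
      using assms(1) by (intro card_image_le) simp
    also have "\<dots> \<le> m + m"
      using assms(2) by (meson add_mono card_Un_le order_trans)
    finally show False using assms(3) by simp
  qed
  obtain i where i: "i < k" "\<And>a. (0, a) \<in> P \<or> (1, a) \<in> P \<Longrightarrow> a div k \<noteq> i"
    using avoid[of 0 1 "\<lambda>a. a div k"] by blast
  obtain j where j: "j < k" "\<And>a. (2, a) \<in> P \<or> (3, a) \<in> P \<Longrightarrow> a mod k \<noteq> j"
    using avoid[of 2 3 "\<lambda>a. a mod k"] by blast
  have "hedge i l \<notin> P" if "l < k" for l
  proof -
    have "(i * k + l) div k = i" using that by simp
    then show ?thesis using i(2)[of "i * k + l"] by (auto simp: hedge_def mod2_eq_if split: if_splits)
  qed
  moreover have "vedge l j \<notin> P" for l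
  proof -
    have "(l * k + j) mod k = j" using j(1) by simp
    moreover have "2 + l mod 2 = 2 \<or> 2 + l mod 2 = 3" by linarith
    ultimately show ?thesis using j(2)[of "l * k + j"] unfolding vedge_def by metis
  qed
  ultimately show ?thesis using i(1) j(1) unfolding free_def by blast
qed

section \<open>The product of signs over all vertices\<close>

lemma prod_shift:
  fixes f :: "nat \<Rightarrow> int"
  shows "(\<Prod>j<k. if Suc j < k then f j else 1) = (\<Prod>j<k. if 0 < j then f (j - 1) else 1)"
proof -
  obtain l where k: "k = Suc l" using k_ge by (cases k) auto
  show ?thesis
    unfolding k by (subst prod.lessThan_Suc, subst prod.lessThan_Suc_shift) simp
qed

text \<open>Each edge enters at both of its ends, so squares of signs are multiplied;
  \<open>prod_shift\<close> reindexes the left and upper edges as right and lower ones.\<close>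

lemma prod_edges:
  assumes "sign_valued f"
  shows "(\<Prod>i<k. \<Prod>j<k. prod_list (map f (edges i j))) = 1"
proof -
  let ?H = "\<Prod>i<k. \<Prod>j<k. if Suc j < k then f (hedge i j) else 1"
  let ?V = "\<Prod>i<k. \<Prod>j<k. if Suc i < k then f (vedge i j) else 1"
  have pl: "prod_list (map f (edges i j)) =
    (if Suc j < k then f (hedge i j) else 1) * (if 0 < j then f (hedge i (j - 1)) else 1) *
    (if Suc i < k then f (vedge i j) else 1) * (if 0 < i then f (vedge (i - 1) j) else 1)" for i j
    by (auto simp: edges_def)
  have H: "(\<Prod>i<k. \<Prod>j<k. if 0 < j then f (hedge i (j - 1)) else 1) = ?H"
    by (simp add: prod_shift)
  have "(\<Prod>j<k. \<Prod>i<k. if 0 < i then f (vedge (i - 1) j) else 1) =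
      (\<Prod>j<k. \<Prod>i<k. if Suc i < k then f (vedge i j) else 1)"
    by (simp only: prod_shift[of "\<lambda>i. f (vedge i _)"])
  then have V: "(\<Prod>i<k. \<Prod>j<k. if 0 < i then f (vedge (i - 1) j) else 1) = ?V"
    by (subst (1 2) prod.swap)
  have sq: "(\<Prod>i<k. \<Prod>j<k. h i j) * (\<Prod>i<k. \<Prod>j<k. h i j) = 1"
    if "\<And>i j. h i j = 1 \<or> h i j = -1" for h :: "nat \<Rightarrow> nat \<Rightarrow> int"
  proof -
    have "h i j * h i j = 1" for i j using that[of i j] by auto
    then show ?thesis by (simp flip: prod.distrib)
  qed
  have H2: "?H * ?H = 1" by (rule sq) (use assms[rule_format, of "hedge _ _"] in auto)
  have V2: "?V * ?V = 1" by (rule sq) (use assms[rule_format, of "vedge _ _"] in auto)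
  then show ?thesis
    unfolding pl prod.distrib H V by (simp only: H2 V2 mult_1_left)
qed

end

section \<open>The encoded relations\<close>

sublocale grid \<subseteq> chains "k * k" .

context grid
begin

definition exactly :: "nat \<times> nat \<Rightarrow> int \<Rightarrow> bool" where
  "exactly e d \<longleftrightarrow> chain_prime (fst e) ^ snd e dvd d \<and> \<not> chain_prime (fst e) ^ Suc (snd e) dvd d"

text \<open>
  For \<open>d\<close> of exact level \<open>a\<close> in chain \<open>c\<close> the character depends only on the leading \<open>c\<close>-adic digit of
  \<open>d\<close>: it tells whether this digit lies in the lower or in the upper half of the nonzero residues.
\<close>

definition chi :: "nat \<times> nat \<Rightarrow> int \<Rightarrow> int" where
  "chi e d = (let M = chain_prime (fst e) ^ Suc (snd e) in if 2 * (d mod M) < M then 1 else -1)"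

definition gadget :: "bool \<Rightarrow> nat \<Rightarrow> nat \<Rightarrow> int \<Rightarrow> bool" where
  "gadget b i j d \<longleftrightarrow> (\<forall>e\<in>set (edges i j). exactly e d) \<and>
     prod_list (map (\<lambda>e. chi e d) (edges i j)) = twist b i j"

text \<open>Label 0 makes the classes modulo \<open>q\<close> recognisable, label 1 links a vertex
  to its translate by \<open>g\<close>, and label \<open>2 + 4 * a + c\<close> makes level
  \<open>a\<close> of chain \<open>c\<close> recognisable. The last \<open>k * k\<close> labels are
  the gadgets, row by row.\<close>

definition rel :: "bool \<Rightarrow> nat \<Rightarrow> int \<Rightarrow> bool" where
  "rel b l d \<longleftrightarrow>
     (if l = 0 then True
      else if l = 1 then \<forall>c<4. chain_prime c ^ Suc (k * k) dvd d
      else if l < 4 * (k * k) + 6 then chain_prime ((l - 2) mod 4) ^ ((l - 2) div 4) dvd d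
      else gadget b ((l - (4 * (k * k) + 6)) div k) ((l - (4 * (k * k) + 6)) mod k) d)"

definition num_labels :: nat where "num_labels = 5 * (k * k) + 6"

text \<open>
  The residue of a difference modulo \<open>q\<close> carries the label of a relation, while the relation itself
  depends on the residue modulo \<open>g\<close>.
\<close>

definition conn :: "bool \<Rightarrow> int \<Rightarrow> bool" where
  "conn b d \<longleftrightarrow> (\<exists>l<num_labels. q dvd d - int l * g \<and> rel b l d)"

text \<open>The factor 2 puts sums of two labels below \<open>q\<close> as well, as
  \<open>conn_same_class\<close> requires.\<close>

lemma num_labels_less: "2 * int num_labels < q"
proof -
  have pow: "x + 1 \<le> 2 ^ x" for x :: nat
    by (induction x) auto
  then have "num_labels + num_labels < 64 * 2 ^ (k * k)"
    unfolding num_labels_def using pow[of "k * k"] by linarith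
  then have "int (2 * num_labels) < int (64 * 2 ^ (k * k))" by (simp only: of_nat_less_iff mult_2)
  then show ?thesis by (simp add: q_def power_add)
qed

lemma label_unique:
  assumes "q dvd d - int l * g" "q dvd d - int l' * g" "l < num_labels" "l' < num_labels"
  shows "l = l'"
proof -
  have "q dvd (int l' - int l) * g"
    using dvd_diff[OF assms(1,2)] by (simp add: algebra_simps)
  then have "q dvd int l' - int l"
    using coprime_q_g by (simp add: coprime_dvd_mult_left_iff)
  moreover have "\<bar>int l' - int l\<bar> < q"
    using assms(3,4) num_labels_less by linarith
  ultimately show ?thesis
    using zdvd_imp_le[of q "\<bar>int l' - int l\<bar>"] by (cases "l = l'") auto
qed

lemma conn_label:
  assumes "q dvd d - int l * g" "l < num_labels"
  shows "conn b d \<longleftrightarrow> rel b l d"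
  using assms label_unique unfolding conn_def by blast

lemma exactly_chi_cong:
  assumes "chain_prime (fst e) ^ Suc (snd e) dvd d - d'"
  shows "exactly e d \<longleftrightarrow> exactly e d'" "chi e d = chi e d'"
proof -
  have "chain_prime (fst e) ^ snd e dvd d - d'"
    using assms by (metis dvd_mult_right power_Suc)
  then show "exactly e d \<longleftrightarrow> exactly e d'"
    unfolding exactly_def
    using assms dvd_add_right_iff[of "chain_prime (fst e) ^ snd e" "d - d'" d']
      dvd_add_right_iff[of "chain_prime (fst e) ^ Suc (snd e)" "d - d'" d'] by simp
  have "d mod chain_prime (fst e) ^ Suc (snd e) = d' mod chain_prime (fst e) ^ Suc (snd e)"
    using assms by (simp only: mod_eq_dvd_iff)
  then show "chi e d = chi e d'" by (simp only: chi_def Let_def)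
qed

lemma chi_sign: "chi e d = 1 \<or> chi e d = -1"
  by (simp add: chi_def Let_def)

text \<open>Negation exchanges the lower and the upper half of the nonzero residues; the odd modulus
  leaves no midpoint.\<close>

lemma chi_minus:
  assumes "exactly e d"
  shows "chi e (- d) = - chi e d"
proof -
  let ?M = "chain_prime (fst e) ^ Suc (snd e)"
  have "d mod ?M \<noteq> 0" using assms by (simp add: exactly_def mod_eq_0_iff_dvd del: power_Suc)
  then have "(- d) mod ?M = ?M - d mod ?M" by (simp add: zmod_zminus1_eq_if del: power_Suc)
  moreover have "odd ?M" using odd_chain_prime by simp
  then have "2 * (d mod ?M) \<noteq> ?M" by (metis dvd_triv_left)
  ultimately show ?thesis by (simp add: chi_def Let_def del: power_Suc)
qed

section \<open>Signed similarity carries the untwisted relations into the twisted ones\<close>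

lemma exactly_pinned:
  assumes "exactly (c, a) (x - y)" "x \<in> X" "y \<in> X" "c < 4" "a \<le> k * k"
  shows "(c, a) \<in> pinned X"
  using assms by (auto simp: pinned_def exact_levels_def exactly_def)

lemma sim_exactly_chi:
  assumes "sim s d d'" "sign_valued s" "c < 4" "a \<le> k * k"
  shows "exactly (c, a) d \<longleftrightarrow> exactly (c, a) d'"
    and "exactly (c, a) d \<Longrightarrow> chi (c, a) d' = s (c, a) * chi (c, a) d"
proof -
  show "exactly (c, a) d \<longleftrightarrow> exactly (c, a) d'"
    using sim_dvd_iff[OF assms(1-3), of a] sim_dvd_iff[OF assms(1-3), of "Suc a"] assms(4)
    by (simp add: exactly_def del: power_Suc)
  assume ex: "exactly (c, a) d"
  then have "chain_prime c ^ Suc a dvd d' - s (c, a) * d"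
    using assms(1,3,4) by (simp add: sim_def exactly_def)
  then have "chi (c, a) d' = chi (c, a) (s (c, a) * d)"
    by (intro exactly_chi_cong) simp
  also have "\<dots> = s (c, a) * chi (c, a) d"
    using assms(2)[rule_format, of "(c, a)"] chi_minus[OF ex] by auto
  finally show "chi (c, a) d' = s (c, a) * chi (c, a) d" .
qed

text \<open>The product of the values of \<open>chi\<close> is multiplied by the product of the
  signs at the vertex, which is exactly the factor between the two gadgets. Parity is demanded only
  if all edges at the vertex are exact levels of \<open>d\<close>; otherwise both gadgets
  fail.\<close>

lemma sim_gadget:
  assumes "sim s d d'" "sign_valued s" "i < k" "j < k"
    and par: "(\<And>e. e \<in> set (edges i j) \<Longrightarrow> exactly e d) \<Longrightarrow> prod_list (map s (edges i j)) = twist True i j"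
  shows "gadget False i j d \<longleftrightarrow> gadget True i j d'"
proof -
  have E: "c < 4 \<and> a \<le> k * k" if "(c, a) \<in> set (edges i j)" for c a
    using edges_range[OF assms(3,4) that] by simp
  have ex: "(\<forall>e\<in>set (edges i j). exactly e d) \<longleftrightarrow> (\<forall>e\<in>set (edges i j). exactly e d')"
    using sim_exactly_chi(1)[OF assms(1,2)] E by (metis surj_pair)
  show ?thesis
  proof (cases "\<forall>e\<in>set (edges i j). exactly e d")
    case True
    have "map (\<lambda>e. chi e d') (edges i j) = map (\<lambda>e. s e * chi e d) (edges i j)"
      using sim_exactly_chi(2)[OF assms(1,2)] E True by (auto intro!: map_cong)
    then have "prod_list (map (\<lambda>e. chi e d') (edges i j)) =
        prod_list (map s (edges i j)) * prod_list (map (\<lambda>e. chi e d) (edges i j))"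
      by (simp only: prod_list_map_mult)
    also have "prod_list (map s (edges i j)) = twist True i j" using par True by blast
    finally show ?thesis
      using True ex twist_sign[of True i j] by (auto simp: gadget_def twist_def)
  next
    case False
    then show ?thesis using ex unfolding gadget_def by blast
  qed
qed

lemma rel_gadget_index:
  assumes "\<not> l < 4 * (k * k) + 6" "l < num_labels"
  shows "(l - (4 * (k * k) + 6)) div k < k" "(l - (4 * (k * k) + 6)) mod k < k"
  using assms k_ge by (simp_all add: num_labels_def less_mult_imp_div_less)

text \<open>All labels but the gadgets depend on valuations alone, which similarity
  preserves.\<close>

lemma sim_conn:
  assumes sim: "sim s d d'" and s: "sign_valued s"
    and par: "\<And>i j. i < k \<Longrightarrow> j < k \<Longrightarrow> (\<And>e. e \<in> set (edges i j) \<Longrightarrow> exactly e d) \<Longrightarrow>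
      prod_list (map s (edges i j)) = twist True i j"
  shows "conn False d \<longleftrightarrow> conn True d'"
proof -
  have "q dvd d - int l * g \<longleftrightarrow> q dvd d' - int l * g" for l
    using sim dvd_add_right_iff[of q "d' - d" "d - int l * g"] by (simp add: sim_def)
  moreover have "rel False l d \<longleftrightarrow> rel True l d'" if l: "l < num_labels" for l
  proof (cases "l < 4 * (k * k) + 6")
    case True
    have "(l - 2) div 4 \<le> Suc (k * k)" if "l < 4 * (k * k) + 6" using that by linarith
    then show ?thesis
      using True sim_dvd_iff[OF sim s, of "(l - 2) mod 4" "(l - 2) div 4"]
        sim_dvd_iff[OF sim s _ order_refl]
      by (simp add: rel_def del: power_Suc)
  next
    case False
    then show ?thesis
      using sim_gadget[OF sim s rel_gadget_index[OF False l] par[OF rel_gadget_index[OF False l]]]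
      by (simp add: rel_def)
  qed
  ultimately show ?thesis unfolding conn_def by (intro ex_cong1 conj_cong) simp_all
qed

section \<open>The duplicator's strategy\<close>

definition modulus :: nat where "modulus = nat (q * g)"

lemma int_modulus: "int modulus = q * g"
  using q_pos g_pos by (simp add: modulus_def)

lemma modulus_pos: "0 < modulus"
  using int_modulus q_pos g_pos by (metis mult_pos_pos of_nat_0_less_iff)

lemma eq_if_dvd_diff: "x < modulus \<Longrightarrow> y < modulus \<Longrightarrow> q * g dvd int x - int y \<Longrightarrow> x = y"
  using zdvd_imp_le[of "int modulus" "\<bar>int x - int y\<bar>"] int_modulus by (cases "x = y") auto

text \<open>The duplicator's invariant: the signs \<open>s\<close> explain all differences of
  pebbles, and their exempt vertex (i, j) lies on a row and a column without pinned edges.\<close>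

definition position :: "nat list \<Rightarrow> nat list \<Rightarrow> bool" where
  "position x y \<longleftrightarrow> length y = length x \<and>
     (\<exists>s i j. sign_valued s \<and> satisfies_off s i j \<and> free (pinned (int ` set x)) i j \<and>
       (\<forall>u<length x. \<forall>w<length x. sim s (int (x ! u) - int (x ! w)) (int (y ! u) - int (y ! w))))"

lemma position_trivial:
  assumes "length x \<le> 1"
  shows "position x x"
  unfolding position_def
proof (intro conjI exI refl)
  show "sign_valued (\<lambda>_. 1 :: int)" by simp
  \<comment> \<open>The constant sign 1 fails only at the corner (0, 0), the exempt vertex.\<close>
  show "satisfies_off (\<lambda>_. 1) 0 0" by (auto simp: satisfies_off_def twist_def map_replicate_const)
  have "x = [] \<or> (\<exists>a. x = [a])" using assms by (cases x) auto
  then have "pinned (int ` set x) = {}" by (auto simp: pinned_def exact_levels_def)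
  then show "free (pinned (int ` set x)) 0 0" using k_ge by (simp add: free_def)
  show "\<forall>u<length x. \<forall>w<length x.
      sim (\<lambda>_. 1) (int (x ! u) - int (x ! w)) (int (x ! u) - int (x ! w))"
    by (simp add: sim_def)
qed

lemma position_eq_iff:
  assumes "position x y" "set x \<subseteq> {..<modulus}" "set y \<subseteq> {..<modulus}" "u < length x" "w < length x"
  shows "x ! u = x ! w \<longleftrightarrow> y ! u = y ! w"
proof -
  obtain s where s: "sign_valued s" "sim s (int (x ! u) - int (x ! w)) (int (y ! u) - int (y ! w))"
    and len: "length y = length x"
    using assms unfolding position_def by blast
  have "z ! u = z ! w \<longleftrightarrow> q * g dvd int (z ! u) - int (z ! w)"
    if "set z \<subseteq> {..<modulus}" "length z = length x" for z
  proof -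
    have "z ! u \<in> set z" "z ! w \<in> set z" using that(2) assms(4,5) by simp_all
    then have "z ! u < modulus" "z ! w < modulus" using that(1) by auto
    then show ?thesis using eq_if_dvd_diff[of "z ! u" "z ! w"] by auto
  qed
  then show ?thesis using sim_eq_iff[OF s(2,1)] assms(2,3) len by simp
qed

text \<open>The exempt vertex has an edge, and none of its edges is pinned, so they are not exact
  levels of any difference of pebbles. Hence the parity condition of \<open>sim_conn\<close> arises
  only at vertices where it holds.\<close>

lemma position_conn_iff:
  assumes "position x y" "u < length x" "w < length x"
  shows "conn False (int (x ! u) - int (x ! w)) \<longleftrightarrow> conn True (int (y ! u) - int (y ! w))"
proof -
  obtain s i j where s: "sign_valued s" "sim s (int (x ! u) - int (x ! w)) (int (y ! u) - int (y ! w))"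
    and ij: "satisfies_off s i j" "free (pinned (int ` set x)) i j"
    using assms unfolding position_def by blast
  show ?thesis
  proof (rule sim_conn[OF s(2,1)])
    fix i' j' assume ij': "i' < k" "j' < k"
      and ex: "\<And>e. e \<in> set (edges i' j') \<Longrightarrow> exactly e (int (x ! u) - int (x ! w))"
    have "(i', j') \<noteq> (i, j)"
    proof
      assume "(i', j') = (i, j)"
      obtain c a where e: "(c, a) \<in> set (edges i' j')"
        using edges_nonempty[of i' j'] by (metis list.set_intros(1) neq_Nil_conv surj_pair)
      then have "(c, a) \<in> pinned (int ` set x)"
        using exactly_pinned[OF ex[OF e]] edges_range[OF ij' e] assms(2,3) by auto
      then show False using free_edges[OF ij(2)] e \<open>(i', j') = (i, j)\<close> by blast
    qed
    then show "prod_list (map s (edges i' j')) = twist True i' j'"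
      using ij(1) ij' unfolding satisfies_off_def by blast
  qed
qed

lemma position_restrict:
  assumes "position x y" "set is \<subseteq> {..<length x}"
  shows "position (map ((!) x) is) (map ((!) y) is)"
proof -
  obtain s i j where s: "sign_valued s" "satisfies_off s i j" "free (pinned (int ` set x)) i j"
    and sims: "\<And>u w. u < length x \<Longrightarrow> w < length x \<Longrightarrow>
      sim s (int (x ! u) - int (x ! w)) (int (y ! u) - int (y ! w))"
    using assms(1) unfolding position_def by blast
  have "int ` set (map ((!) x) is) \<subseteq> int ` set x"
    using assms(2) by (intro image_mono) auto
  then have "free (pinned (int ` set (map ((!) x) is))) i j"
    by (rule free_mono[OF s(3) pinned_mono])
  moreover have "is ! u < length x" if "u < length is" for u
    using that assms(2) nth_mem by blast
  ultimately show ?thesis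
    unfolding position_def using s(1,2) sims by (intro conjI exI[of _ s] exI[of _ i] exI[of _ j]) auto
qed

lemma residue_exists_nat:
  "\<exists>z<modulus. q dvd int z - w \<and> (\<forall>c<4. chain_prime c ^ Suc (k * k) dvd int z - r c)"
proof -
  obtain z where z: "q dvd z - w" "\<forall>c<4. chain_prime c ^ Suc (k * k) dvd z - r c"
    using residues_exist by blast
  let ?z = "nat (z mod (q * g))"
  have pos: "0 < q * g" using q_pos g_pos by simp
  have eq: "int ?z = z mod (q * g)" using pos by simp
  have "z mod (q * g) < q * g" using pos by simp
  then have "?z < modulus" using eq int_modulus by linarith
  have diff: "m dvd int ?z - r' " if "m dvd z - r'" "m dvd q * g" for m r'
  proof -
    have "q * g dvd z - int ?z" unfolding eq by (simp add: minus_mod_eq_mult_div)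
    then have "m dvd z - int ?z" using that(2) dvd_trans by blast
    from dvd_diff[OF that(1) this] show ?thesis by simp
  qed
  have "chain_prime c ^ Suc (k * k) dvd q * g" if "c < 4" for c
    using chain_dvd_g[OF that order_refl] by (rule dvd_mult)
  then have "\<forall>c<4. chain_prime c ^ Suc (k * k) dvd int ?z - r c"
    using z(2) diff by blast
  moreover have "q dvd int ?z - w" using z(1) by (rule diff) simp
  ultimately show ?thesis using \<open>?z < modulus\<close> by blast
qed

end

context grid
begin

lemma pinned_insert:
  "pinned (insert \<alpha> X) = pinned X \<union> {e. fst e < 4 \<and> snd e \<le> k * k \<and> (\<exists>x\<in>X. exactly e (\<alpha> - x))}"
proof -
  have sym: "exactly e (y - \<alpha>) \<longleftrightarrow> exactly e (\<alpha> - y)" for e y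
    by (simp add: exactly_def dvd_diff_commute)
  have zero: "\<not> exactly e 0" for e
    by (simp add: exactly_def)
  have pinned_alt: "pinned Y = {e. fst e < 4 \<and> snd e \<le> k * k \<and> (\<exists>x\<in>Y. \<exists>y\<in>Y. exactly e (x - y))}" for Y
    unfolding pinned_def exact_levels_def exactly_def by (simp add: case_prod_beta')
  have "(\<exists>x\<in>insert \<alpha> X. \<exists>y\<in>insert \<alpha> X. exactly e (x - y)) \<longleftrightarrow>
      (\<exists>x\<in>X. \<exists>y\<in>X. exactly e (x - y)) \<or> (\<exists>x\<in>X. exactly e (\<alpha> - x))" for e
    by (auto simp: sym zero)
  then show ?thesis unfolding pinned_alt by (auto simp only: mem_Collect_eq)
qed

text \<open>New signs, nearest pebbles and levels are functions of the divisibility profile of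
  \<open>\<alpha>\<close> alone. This profile can be read off from \<open>\<phi> \<alpha>\<close>,
  so the image determines the choices and then, coordinate by coordinate, \<open>\<alpha>\<close>
  itself: \<open>\<phi>\<close> is injective.\<close>

lemma position_extend:
  assumes pos: "position x y" and len: "length x \<le> m" and m: "2 * m < k"
    and x: "set x \<subseteq> {..<modulus}"
  shows "\<exists>\<phi>. bij_betw \<phi> {..<modulus} {..<modulus} \<and> (\<forall>\<alpha><modulus. position (\<alpha> # x) (\<phi> \<alpha> # y))"
proof (cases "x = []")
  case True
  then have "y = []" using pos by (simp add: position_def)
  then show ?thesis using True position_trivial by (intro exI[of _ "\<lambda>\<alpha>. \<alpha>"]) (auto simp: bij_betw_def)
next
  case False
  then have l0: "0 < length x" by simp
  have leny: "length y = length x" using pos by (simp add: position_def)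
  obtain s i j where s: "sign_valued s" "satisfies_off s i j" "free (pinned (int ` set x)) i j"
    and sims: "\<And>u w. u < length x \<Longrightarrow> w < length x \<Longrightarrow>
      sim s (int (x ! u) - int (x ! w)) (int (y ! u) - int (y ! w))"
    using pos unfolding position_def by blast
  define profile where "profile \<alpha> = {(u, c, a). u < length x \<and> c < 4 \<and> a \<le> Suc (k * k) \<and>
      chain_prime c ^ a dvd int \<alpha> - int (x ! u)}" for \<alpha>
  define levels where "levels \<pi> = {e. fst e < 4 \<and> snd e \<le> k * k \<and>
      (\<exists>u<length x. (u, fst e, snd e) \<in> \<pi> \<and> (u, fst e, Suc (snd e)) \<notin> \<pi>)}"
    for \<pi> :: "(nat \<times> nat \<times> nat) set"
  \<comment> \<open>The data for a profile: new signs, a new hiding place, and in each chain the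
    index \<open>t c\<close> of a nearest pebble with its level \<open>v c\<close>.\<close>
  define ok where "ok \<pi> D = (case D of (s', i', j', t, v) \<Rightarrow>
      sign_valued s' \<and> satisfies_off s' i' j' \<and> free (pinned (int ` set x) \<union> levels \<pi>) i' j' \<and>
      (\<forall>e\<in>pinned (int ` set x). s' e = s e) \<and>
      (\<forall>c<4. t c < length x \<and> (\<forall>u a. (u, c, a) \<in> \<pi> \<longrightarrow> (t c, c, a) \<in> \<pi>) \<and>
        v c \<le> k * k \<and> (t c, c, v c) \<in> \<pi> \<and> (\<forall>a\<le>k * k. (t c, c, a) \<in> \<pi> \<longrightarrow> a \<le> v c)))"
    for \<pi> and D :: "(nat \<times> nat \<Rightarrow> int) \<times> nat \<times> nat \<times> (nat \<Rightarrow> nat) \<times> (nat \<Rightarrow> nat)"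
  have pinned_cons: "pinned (int ` set (\<alpha> # x)) = pinned (int ` set x) \<union> levels (profile \<alpha>)" for \<alpha>
  proof -
    have "(\<exists>z\<in>int ` set x. exactly e (int \<alpha> - z)) \<longleftrightarrow>
        (\<exists>u<length x. (u, fst e, snd e) \<in> profile \<alpha> \<and> (u, fst e, Suc (snd e)) \<notin> profile \<alpha>)"
      if "fst e < 4" "snd e \<le> k * k" for e
    proof -
      have "(\<exists>z\<in>int ` set x. R z) \<longleftrightarrow> (\<exists>u<length x. R (int (x ! u)))" for R
        unfolding set_conv_nth by blast
      then have "(\<exists>z\<in>int ` set x. exactly e (int \<alpha> - z)) \<longleftrightarrow>
          (\<exists>u<length x. exactly e (int \<alpha> - int (x ! u)))" .
      also have "(\<exists>u<length x. exactly e (int \<alpha> - int (x ! u))) \<longleftrightarrow>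
          (\<exists>u<length x. (u, fst e, snd e) \<in> profile \<alpha> \<and> (u, fst e, Suc (snd e)) \<notin> profile \<alpha>)"
      proof (intro ex_cong1 conj_cong refl)
        fix u assume "u < length x"
        then show "exactly e (int \<alpha> - int (x ! u)) \<longleftrightarrow>
          (u, fst e, snd e) \<in> profile \<alpha> \<and> (u, fst e, Suc (snd e)) \<notin> profile \<alpha>"
          using that by (cases e) (simp add: profile_def exactly_def del: power_Suc)
      qed
      finally show ?thesis .
    qed
    then show ?thesis
      unfolding list.set image_insert pinned_insert levels_def by blast
  qed
  have ex: "\<exists>D. ok (profile \<alpha>) D" for \<alpha>
  proof -
    let ?X = "int ` set x" and ?X' = "int ` set (\<alpha> # x)"
    \<comment> \<open>At most \<open>m + 1\<close> pebbles pin at most \<open>m\<close> levels per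
      chain.\<close>
    have "card ?X' \<le> Suc m"
      using len card_length[of "\<alpha> # x"] card_image_le[of "set (\<alpha> # x)" int] by simp
    then have "card {a. (c, a) \<in> pinned ?X'} \<le> m" for c
      using card_pinned(2)[of ?X' c] by simp
    with m obtain i' j' where f: "free (pinned ?X') i' j'"
      using free_exists[of "pinned ?X'" m] card_pinned(1)[of ?X'] by auto
    obtain s' where s': "sign_valued s'" "satisfies_off s' i' j'" "\<forall>e\<in>pinned ?X. s' e = s e"
      using move_free[OF s(1,2,3) free_mono[OF f pinned_mono]] by auto
    have "\<exists>t. t < length x \<and> (\<forall>u a. (u, c, a) \<in> profile \<alpha> \<longrightarrow> (t, c, a) \<in> profile \<alpha>)" if "c < 4" for c
    proof -
      have "finite ?X" "?X \<noteq> {}" using False by auto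
      from nearest_exists[OF this, of "Suc (k * k)" "chain_prime c" "int \<alpha>"]
      obtain t where "t < length x" and near: "\<And>u a. u < length x \<Longrightarrow> a \<le> Suc (k * k) \<Longrightarrow>
          chain_prime c ^ a dvd int \<alpha> - int (x ! u) \<Longrightarrow> chain_prime c ^ a dvd int \<alpha> - int (x ! t)"
        by (auto simp: in_set_conv_nth) (metis nth_mem)
      then show ?thesis unfolding profile_def by blast
    qed
    then obtain t where t: "\<And>c. c < 4 \<Longrightarrow> t c < length x"
      "\<And>c u a. c < 4 \<Longrightarrow> (u, c, a) \<in> profile \<alpha> \<Longrightarrow> (t c, c, a) \<in> profile \<alpha>" by metis
    \<comment> \<open>The cap \<open>k * k\<close> also covers a difference divisible by the top
      power, where a sign changes nothing modulo that power.\<close>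
    define v where "v c = Max {a. a \<le> k * k \<and> (t c, c, a) \<in> profile \<alpha>}" for c
    have v: "v c \<le> k * k \<and> (t c, c, v c) \<in> profile \<alpha> \<and> (\<forall>a\<le>k * k. (t c, c, a) \<in> profile \<alpha> \<longrightarrow> a \<le> v c)"
      if "c < 4" for c
    proof -
      let ?S = "{a. a \<le> k * k \<and> (t c, c, a) \<in> profile \<alpha>}"
      have S: "finite ?S" by simp
      have "0 \<in> ?S" using t(1)[OF that] that by (simp add: profile_def)
      then have "Max ?S \<in> ?S" using Max_in[OF S] by blast
      moreover have "a \<le> Max ?S" if "a \<in> ?S" for a using Max_ge[OF S that] .
      ultimately show ?thesis unfolding v_def by blast
    qed
    have "ok (profile \<alpha>) (s', i', j', t, v)"
      unfolding ok_def prod.case using s' f t v unfolding pinned_cons by blast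
    then show ?thesis by blast
  qed
  \<comment> \<open>One choice per profile, not per vertex: equal profiles receive equal data, on
    which injectivity rests.\<close>
  define D where "D \<pi> = (SOME D. ok \<pi> D)" for \<pi>
  define S where "S \<alpha> = fst (D (profile \<alpha>))" for \<alpha>
  define T where "T \<alpha> = fst (snd (snd (snd (D (profile \<alpha>)))))" for \<alpha>
  define V where "V \<alpha> = snd (snd (snd (snd (D (profile \<alpha>)))))" for \<alpha>
  have "ok (profile \<alpha>) (D (profile \<alpha>))" for \<alpha>
    unfolding D_def using ex by (rule someI_ex)
  then have D: "\<exists>i' j'. ok (profile \<alpha>) (S \<alpha>, i', j', T \<alpha>, V \<alpha>)" for \<alpha>
    unfolding S_def T_def V_def by (metis prod.collapse)
  then have S: "sign_valued (S \<alpha>)" "\<And>e. e \<in> pinned (int ` set x) \<Longrightarrow> S \<alpha> e = s e"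
    and T: "\<And>c. c < 4 \<Longrightarrow> T \<alpha> c < length x"
      "\<And>c u a. c < 4 \<Longrightarrow> (u, c, a) \<in> profile \<alpha> \<Longrightarrow> (T \<alpha> c, c, a) \<in> profile \<alpha>"
    and V: "\<And>c. c < 4 \<Longrightarrow> V \<alpha> c \<le> k * k" "\<And>c. c < 4 \<Longrightarrow> (T \<alpha> c, c, V \<alpha> c) \<in> profile \<alpha>"
      "\<And>c a. c < 4 \<Longrightarrow> a \<le> k * k \<Longrightarrow> (T \<alpha> c, c, a) \<in> profile \<alpha> \<Longrightarrow> a \<le> V \<alpha> c"
    for \<alpha>
    unfolding ok_def by fastforce+
  have goal: "\<exists>i' j'. satisfies_off (S \<alpha>) i' j' \<and> free (pinned (int ` set (\<alpha> # x))) i' j'" for \<alpha>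
    using D[of \<alpha>] unfolding ok_def pinned_cons by auto
  have "\<exists>z<modulus. q dvd int z - (int (y ! 0) + (int \<alpha> - int (x ! 0))) \<and>
      (\<forall>c<4. chain_prime c ^ Suc (k * k) dvd
        int z - (int (y ! T \<alpha> c) + S \<alpha> (c, V \<alpha> c) * (int \<alpha> - int (x ! T \<alpha> c))))" for \<alpha>
    by (rule residue_exists_nat)
  then obtain \<phi> where \<phi>: "\<And>\<alpha>. \<phi> \<alpha> < modulus"
    "\<And>\<alpha>. q dvd int (\<phi> \<alpha>) - (int (y ! 0) + (int \<alpha> - int (x ! 0)))"
    "\<And>\<alpha> c. c < 4 \<Longrightarrow> chain_prime c ^ Suc (k * k) dvd
        int (\<phi> \<alpha>) - (int (y ! T \<alpha> c) + S \<alpha> (c, V \<alpha> c) * (int \<alpha> - int (x ! T \<alpha> c)))"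
    by metis
  \<comment> \<open>Every exact level of an old difference is pinned, and signs were kept on pinned
    levels.\<close>
  have sims': "sim (S \<alpha>) (int (x ! u) - int (x ! w)) (int (y ! u) - int (y ! w))"
    if uw: "u < length x" "w < length x" for \<alpha> u w
  proof (rule sim_change[OF sims[OF uw] s(1) S(1)])
    fix c a assume "c < 4" "a \<le> k * k" "chain_prime c ^ a dvd int (x ! u) - int (x ! w)"
      "\<not> chain_prime c ^ Suc a dvd int (x ! u) - int (x ! w)"
    then have "(c, a) \<in> pinned (int ` set x)"
      using uw by (intro exactly_pinned[of c a "int (x ! u)" "int (x ! w)"]) (auto simp: exactly_def)
    then show "S \<alpha> (c, a) = s (c, a)" by (rule S(2))
  qed
  have new: "sim (S \<alpha>) (int \<alpha> - int (x ! u)) (int (\<phi> \<alpha>) - int (y ! u))" if u: "u < length x" for \<alpha> u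
  proof -
    have "sim (S \<alpha>) (int \<alpha> - map int x ! u) (int (\<phi> \<alpha>) - map int y ! u)"
    proof (rule sim_extend[where t = "T \<alpha>" and v = "V \<alpha>"])
      show "chain_prime c ^ a dvd int \<alpha> - map int x ! T \<alpha> c"
        if "c < 4" "u < length (map int x)" "a \<le> Suc (k * k)" "chain_prime c ^ a dvd int \<alpha> - map int x ! u" for c u a
      proof -
        have "(u, c, a) \<in> profile \<alpha>" using that by (simp add: profile_def)
        from T(2)[OF that(1) this] show ?thesis using that T(1) by (simp add: profile_def)
      qed
      show "a \<le> V \<alpha> c" if "c < 4" "a \<le> k * k" "chain_prime c ^ a dvd int \<alpha> - map int x ! T \<alpha> c" for c a
      proof (rule V(3)[OF that(1,2)])
        show "(T \<alpha> c, c, a) \<in> profile \<alpha>" using that T(1) by (simp add: profile_def)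
      qed
      show "chain_prime c ^ V \<alpha> c dvd int \<alpha> - map int x ! T \<alpha> c" if "c < 4" for c
        using V(2)[OF that] T(1)[OF that] by (simp add: profile_def)
    qed (use S(1) l0 leny sims' T(1) V(1) \<phi>(2,3) u in \<open>simp_all del: power_Suc\<close>)
    then show ?thesis using u leny by simp
  qed
  \<comment> \<open>Similarity preserves divisibility, so \<open>\<alpha>\<close> has the same
    profile over \<open>x\<close> as its image has over \<open>y\<close>.\<close>
  have prof_iff: "(u, c, a) \<in> profile \<alpha> \<longleftrightarrow> u < length x \<and> c < 4 \<and> a \<le> Suc (k * k) \<and>
      chain_prime c ^ a dvd int (\<phi> \<alpha>) - int (y ! u)" for u c a \<alpha>
    using sim_dvd_iff[OF new S(1)] by (auto simp: profile_def)
  have "inj_on \<phi> {..<modulus}"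
  proof (rule inj_onI)
    fix \<alpha> \<beta> assume ab: "\<alpha> \<in> {..<modulus}" "\<beta> \<in> {..<modulus}" "\<phi> \<alpha> = \<phi> \<beta>"
    have "profile \<alpha> = profile \<beta>" using prof_iff ab(3) by auto
    then have same: "S \<alpha> = S \<beta>" "T \<alpha> = T \<beta>" "V \<alpha> = V \<beta>" by (simp_all add: S_def T_def V_def)
    have "q dvd int \<alpha> - int \<beta>"
      using dvd_diff[OF \<phi>(2)[of \<beta>] \<phi>(2)[of \<alpha>]] ab(3) by (simp add: algebra_simps)
    moreover have "chain_prime c ^ Suc (k * k) dvd int \<alpha> - int \<beta>" if "c < 4" for c
    proof -
      have "chain_prime c ^ Suc (k * k) dvd S \<beta> (c, V \<beta> c) * (int \<alpha> - int \<beta>)"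
        using dvd_diff[OF \<phi>(3)[OF that, of \<beta>] \<phi>(3)[OF that, of \<alpha>]] ab(3) same
        by (simp add: algebra_simps)
      then show ?thesis using dvd_sign_mult[OF S(1)] by blast
    qed
    ultimately have "q * g dvd int \<alpha> - int \<beta>" by (rule qg_dvdI)
    then show "\<alpha> = \<beta>" using eq_if_dvd_diff ab by auto
  qed
  moreover have "\<phi> ` {..<modulus} \<subseteq> {..<modulus}" using \<phi>(1) by auto
  ultimately have "bij_betw \<phi> {..<modulus} {..<modulus}"
    by (simp add: bij_betw_def endo_inj_surj)
  moreover have "position (\<alpha> # x) (\<phi> \<alpha> # y)" for \<alpha>
  proof -
    obtain i' j' where ij: "satisfies_off (S \<alpha>) i' j'" "free (pinned (int ` set (\<alpha> # x))) i' j'"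
      using goal by blast
    have rev: "sim (S \<alpha>) (int (x ! u) - int \<alpha>) (int (y ! u) - int (\<phi> \<alpha>))" if "u < length x" for u
      using sim_minus[OF new[OF that]] by simp
    have all: "sim (S \<alpha>) (int ((\<alpha> # x) ! u) - int ((\<alpha> # x) ! w)) (int ((\<phi> \<alpha> # y) ! u) - int ((\<phi> \<alpha> # y) ! w))"
      if "u < length (\<alpha> # x)" "w < length (\<alpha> # x)" for u w
      using that new rev sims' sim_refl_0 by (cases u; cases w) auto
    show ?thesis
      unfolding position_def
    proof (intro conjI exI)
      show "length (\<phi> \<alpha> # y) = length (\<alpha> # x)" using leny by simp
      show "sign_valued (S \<alpha>)" by (rule S(1))
    qed (use ij all in blast)+
  qed
  ultimately show ?thesis by blast
qed

end

section \<open>The two twists are not isomorphic\<close>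

context grid
begin

lemma dvd_cong_diff: "(m::int) dvd d - d' \<Longrightarrow> m dvd d \<longleftrightarrow> m dvd d'"
  using dvd_add_right_iff[of m "d - d'" d'] by simp

text \<open>Gadgets use levels below \<open>k * k\<close> and level relations stop at
  \<open>k * k\<close>, so only label 1 sees the top power of a chain. This is what singles out
  label 1.\<close>

lemma rel_cong:
  assumes A: "\<And>c a. c < 4 \<Longrightarrow> a \<le> k * k \<Longrightarrow> chain_prime c ^ a dvd d - d'"
    and B: "\<And>c. l = 1 \<Longrightarrow> c < 4 \<Longrightarrow> chain_prime c ^ Suc (k * k) dvd d - d'"
    and l: "l < num_labels"
  shows "rel b l d \<longleftrightarrow> rel b l d'"
proof (cases "l < 4 * (k * k) + 6")
  case True
  have "(l - 2) div 4 \<le> k * k" using True by linarith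
  then have "chain_prime ((l - 2) mod 4) ^ ((l - 2) div 4) dvd d - d'" by (intro A) simp_all
  note level = dvd_cong_diff[OF this]
  show ?thesis
  proof (cases "l = 1")
    case True
    have "chain_prime c ^ Suc (k * k) dvd d \<longleftrightarrow> chain_prime c ^ Suc (k * k) dvd d'" if "c < 4" for c
      by (rule dvd_cong_diff[OF B[OF True that]])
    then show ?thesis using True by (simp add: rel_def del: power_Suc)
  next
    case False
    then show ?thesis using \<open>l < 4 * (k * k) + 6\<close> level by (simp add: rel_def)
  qed
next
  case False
  let ?i = "(l - (4 * (k * k) + 6)) div k" and ?j = "(l - (4 * (k * k) + 6)) mod k"
  have dv: "chain_prime (fst e) ^ Suc (snd e) dvd d - d'" if e: "e \<in> set (edges ?i ?j)" for e
    using edges_range[OF rel_gadget_index[OF False l], of "fst e" "snd e"] e by (intro A) auto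
  have "(\<forall>e\<in>set (edges ?i ?j). exactly e d) \<longleftrightarrow> (\<forall>e\<in>set (edges ?i ?j). exactly e d')"
    using exactly_chi_cong(1)[OF dv] by blast
  moreover have "map (\<lambda>e. chi e d) (edges ?i ?j) = map (\<lambda>e. chi e d') (edges ?i ?j)"
    using exactly_chi_cong(2)[OF dv] by simp
  ultimately have "gadget b ?i ?j d \<longleftrightarrow> gadget b ?i ?j d'" by (simp only: gadget_def)
  then show ?thesis using False by (simp add: rel_def)
qed

lemma rel_cong_g:
  assumes "g dvd d - d'" "l < num_labels"
  shows "rel b l d \<longleftrightarrow> rel b l d'"
proof (rule rel_cong[OF _ _ assms(2)])
  show "chain_prime c ^ a dvd d - d'" if "c < 4" "a \<le> k * k" for c a
    using dvd_trans[OF chain_dvd_g[of c a] assms(1)] that by simp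
  show "chain_prime c ^ Suc (k * k) dvd d - d'" if "c < 4" for c
    by (rule dvd_trans[OF chain_dvd_g[OF that order_refl] assms(1)])
qed

lemma conn_cong:
  assumes "q * g dvd d - d'"
  shows "conn b d \<longleftrightarrow> conn b d'"
proof -
  have "q dvd d - d'" "g dvd d - d'"
    using assms by (auto elim: dvd_mult_left dvd_mult_right)
  moreover have "q dvd d - int l * g \<longleftrightarrow> q dvd d' - int l * g" for l
    using \<open>q dvd d - d'\<close> dvd_add_right_iff[of q "d - d'" "d' - int l * g"] by simp
  ultimately show ?thesis
    unfolding conn_def using rel_cong_g by (intro ex_cong1 conj_cong) simp_all
qed

section \<open>Recovering the labelled relations from the arcs\<close>

lemma rel_level:
  assumes "c < 4" "a \<le> k * k"
  shows "rel b (2 + 4 * a + c) d \<longleftrightarrow> chain_prime c ^ a dvd d" "2 + 4 * a + c < num_labels"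
proof -
  have "(4 * a + c) mod 4 = c" "(4 * a + c) div 4 = a" "2 + 4 * a + c < 4 * (k * k) + 6"
    using assms by auto
  then show "rel b (2 + 4 * a + c) d \<longleftrightarrow> chain_prime c ^ a dvd d"
    by (simp add: rel_def)
  show "2 + 4 * a + c < num_labels" using assms by (simp add: num_labels_def)
qed

lemma rel_gadget:
  assumes "i < k" "j < k"
  shows "rel b (4 * (k * k) + 6 + (i * k + j)) d \<longleftrightarrow> gadget b i j d"
    "4 * (k * k) + 6 + (i * k + j) < num_labels"
  using assms index_less[OF assms] by (simp_all add: rel_def num_labels_def)

text \<open>Two labels with sum 0 modulo \<open>q\<close> are both 0, so only label 0 occurs in both
  directions. Hence the arcs determine the classes modulo \<open>q\<close>.\<close>

lemma conn_same_class: "q dvd d \<longleftrightarrow> conn b d \<and> conn b (- d)"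
proof
  assume "q dvd d"
  then show "conn b d \<and> conn b (- d)"
    using conn_label[of d 0] conn_label[of "- d" 0] by (simp add: rel_def num_labels_def)
next
  assume "conn b d \<and> conn b (- d)"
  then obtain l l' where l: "l < num_labels" "q dvd d - int l * g"
    and l': "l' < num_labels" "q dvd - d - int l' * g"
    unfolding conn_def by blast
  have "(d - int l * g) + (- d - int l' * g) = - ((int l + int l') * g)"
    by (simp add: algebra_simps)
  then have "q dvd (int l + int l') * g"
    using dvd_add[OF l(2) l'(2)] by (metis dvd_minus_iff)
  then have "q dvd int l + int l'"
    using coprime_q_g by (simp add: coprime_dvd_mult_left_iff)
  then have "l = 0"
    using num_labels_less l(1) l'(1) zdvd_imp_le[of q "int l + int l'"] by (cases "l = 0") auto
  then show "q dvd d" using l(2) by simp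
qed

text \<open>A power of the prime has leading digit 1, in the lower half because the prime exceeds
  2.\<close>

lemma chi_1:
  assumes "chain_prime (fst e) ^ Suc (snd e) dvd d - chain_prime (fst e) ^ snd e"
  shows "exactly e d" "chi e d = 1"
proof -
  let ?p = "chain_prime (fst e)" and ?a = "snd e"
  have p: "2 < ?p" by (simp add: chain_prime_def)
  then have less: "2 * ?p ^ ?a < ?p ^ Suc ?a" "0 < ?p ^ ?a" by simp_all
  then have "\<not> ?p ^ Suc ?a dvd ?p ^ ?a"
    using zdvd_imp_le[of "?p ^ Suc ?a" "?p ^ ?a"] by linarith
  then have "exactly e (?p ^ ?a)" by (simp add: exactly_def)
  then show "exactly e d" using exactly_chi_cong(1)[OF assms] by blast
  have "?p ^ ?a mod ?p ^ Suc ?a = ?p ^ ?a"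
    using less by (intro mod_pos_pos_trivial) linarith+
  then have "chi e (?p ^ ?a) = 1" using less by (simp only: chi_def Let_def if_True)
  then show "chi e d = 1" using exactly_chi_cong(2)[OF assms] by simp
qed

lemma prod_twist: "(\<Prod>i<k. \<Prod>j<k. twist True i j) = -1"
proof -
  have "twist True i j = (if i = 0 then if j = 0 then -1 else 1 else 1)" for i j
    by (simp add: twist_def)
  then have "(\<Prod>j<k. twist True i j) = (if i = 0 then -1 else 1)" for i
    using k_ge by simp
  then show ?thesis using k_ge by simp
qed

text \<open>\<open>F\<close> lifts an isomorphism to the integers. It respects the classes modulo
  \<open>q\<close> and commutes with translation by \<open>g\<close>, hence preserves each labelled
  relation separately. Levels and gadgets then yield edge signs whose product over all vertices is
  -1, against \<open>prod_edges\<close>.\<close>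

lemma conn_not_iso:
  assumes conn: "\<And>x y. conn False (y - x) \<longleftrightarrow> conn True (F y - F x)"
    and inj: "\<And>x y. q * g dvd F x - F y \<longleftrightarrow> q * g dvd x - y"
    and surj: "\<And>z. \<exists>x. q * g dvd F x - z"
  shows False
proof -
  have class_iff: "q dvd y - x \<longleftrightarrow> q dvd F y - F x" for x y
    using conn[of y x] conn[of x y] conn_same_class[of "y - x" False] conn_same_class[of "F y - F x" True]
    by simp
  have shift: "q * g dvd F (x + g) - F x - g" for x
  proof -
    let ?D = "F (x + g) - F x"
    have "conn False g"
      using conn_label[of g 1 False] chain_dvd_g[OF _ order_refl]
      by (simp add: rel_def num_labels_def del: power_Suc)
    then have "conn True ?D" using conn[of "x + g" x] by simp
    then obtain l where l: "l < num_labels" "q dvd ?D - int l * g" "rel True l ?D"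
      unfolding conn_def by blast
    have "l = 1"
    proof (rule ccontr)
      assume "l \<noteq> 1"
      \<comment> \<open>\<open>t\<close> is 0 modulo \<open>q\<close> and of exact level
        \<open>k * k\<close> in every chain, so it is nonzero modulo \<open>g\<close> but invisible
        to all labels except 1. For \<open>l \<noteq> 1\<close> the arc to \<open>F (x + g)\<close>
        would have a companion into the same class, whereas label 1 admits only one head.\<close>
      obtain t where t: "q dvd t - 0"
        "\<And>c. c < 4 \<Longrightarrow> chain_prime c ^ Suc (k * k) dvd t - chain_prime c ^ (k * k)"
        using residues_exist[of 0 "\<lambda>c. chain_prime c ^ (k * k)"] by blast
      have ex: "exactly (c, k * k) t" if "c < 4" for c
        using chi_1(1)[of "(c, k * k)" t] t(2)[OF that] by simp
      then have t_dvd: "chain_prime c ^ a dvd t" if "c < 4" "a \<le> k * k" for c a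
        using dvd_trans[OF le_imp_power_dvd[OF that(2)], of "chain_prime c" t] ex[OF that(1)]
        by (simp add: exactly_def)
      have "rel True l (?D + t) \<longleftrightarrow> rel True l ?D"
        using \<open>l \<noteq> 1\<close> l(1) t_dvd by (intro rel_cong) auto
      moreover have "q dvd ?D + t - int l * g"
        using dvd_add[OF l(2) t(1)] by (simp add: algebra_simps)
      ultimately have c1: "conn True (?D + t)" using l conn_def by blast
      obtain z where z: "q * g dvd F z - (F (x + g) + t)" using surj by blast
      have "q * g dvd (F z - F x) - (?D + t)" using z by (simp add: algebra_simps)
      then have "conn True (F z - F x)" using c1 conn_cong by blast
      then have c2: "conn False (z - x)" using conn by blast
      have "q dvd F z - (F (x + g) + t)" using z by (rule dvd_mult_left)
      then have "q dvd F z - F (x + g)"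
        using dvd_add[OF _ t(1), of "F z - (F (x + g) + t)"] by simp
      then have qz: "q dvd z - (x + g)" using class_iff by blast
      then have "q dvd (z - x) - int 1 * g" by (simp add: algebra_simps)
      then have "rel False 1 (z - x)" using c2 conn_label[of "z - x" 1 False] by (simp add: num_labels_def)
      then have "chain_prime c ^ Suc (k * k) dvd z - (x + g)" if "c < 4" for c
        using that dvd_diff[OF _ chain_dvd_g[OF that order_refl], of "z - x"]
        by (simp add: rel_def algebra_simps del: power_Suc)
      with qz have "q * g dvd z - (x + g)" by (rule qg_dvdI)
      then have "q * g dvd F z - F (x + g)" using inj by blast
      from dvd_diff[OF this z] have "q * g dvd t" by simp
      then have "g dvd t" by (rule dvd_mult_right)
      then have "chain_prime 0 ^ Suc (k * k) dvd t"
        using chain_dvd_g[of 0, OF _ order_refl] dvd_trans by auto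
      then show False using ex[of 0] by (simp add: exactly_def)
    qed
    show ?thesis
    proof (rule qg_dvdI)
      show "q dvd ?D - g" using l(2) \<open>l = 1\<close> by simp
      show "chain_prime c ^ Suc (k * k) dvd ?D - g" if "c < 4" for c
      proof (rule dvd_diff[OF _ chain_dvd_g[OF that order_refl]])
        show "chain_prime c ^ Suc (k * k) dvd ?D"
          using l(3) \<open>l = 1\<close> that by (simp add: rel_def del: power_Suc)
      qed
    qed
  qed
  have shifts: "q * g dvd F (x + int l * g) - F x - int l * g" for x l
  proof (induction l)
    case (Suc l)
    from dvd_add[OF Suc shift[of "x + int l * g"]] show ?case by (simp add: algebra_simps)
  qed simp
  \<comment> \<open>Translating the head by \<open>l * g\<close> turns a difference divisible by
    \<open>q\<close> into one of label \<open>l\<close>, where \<open>conn\<close> is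
    \<open>rel\<close> at \<open>l\<close>; \<open>F\<close> commutes with this translation.\<close>
  have transfer: "rel False l d \<longleftrightarrow> rel True l (F (x + d) - F x)"
    if d: "q dvd d" and l: "l < num_labels" for d l x
  proof -
    let ?D = "F (x + d) - F x"
    have "rel False l d \<longleftrightarrow> rel False l (d + int l * g)"
      using l by (intro rel_cong_g) simp_all
    also have "\<dots> \<longleftrightarrow> conn False (d + int l * g)"
      using conn_label[of "d + int l * g" l False] d l by simp
    also have "\<dots> \<longleftrightarrow> conn True (F (x + d + int l * g) - F x)"
      using conn[of "x + d + int l * g" x] by (simp add: algebra_simps)
    also have "\<dots> \<longleftrightarrow> conn True (?D + int l * g)"
      using shifts[of "x + d" l] by (intro conn_cong) (simp add: algebra_simps)
    also have "\<dots> \<longleftrightarrow> rel True l (?D + int l * g)"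
      using conn_label[of "?D + int l * g" l True] d l class_iff[of "x + d" x] by simp
    also have "\<dots> \<longleftrightarrow> rel True l ?D"
      using l by (intro rel_cong_g) simp_all
    finally show ?thesis .
  qed
  \<comment> \<open>For an edge \<open>e\<close> the element \<open>U e\<close> has leading digit 1
    at the level of \<open>e\<close> and vanishes in the other chains; \<open>f e\<close> records
    the sign of its image relative to that of 0.\<close>
  have "\<exists>u. q dvd u - 0 \<and> (\<forall>c<4. chain_prime c ^ Suc (k * k) dvd
      u - (if c = fst e then chain_prime c ^ snd e else 0))" for e :: "nat \<times> nat"
    by (rule residues_exist)
  then obtain U where U: "\<And>e. q dvd U e - 0"
    "\<And>e c. c < 4 \<Longrightarrow> chain_prime c ^ Suc (k * k) dvd U e - (if c = fst e then chain_prime c ^ snd e else 0)"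
    by metis
  define f where "f e = chi e (F (U e) - F 0)" for e
  have "prod_list (map f (edges i j)) = twist True i j" if ij: "i < k" "j < k" for i j
  proof -
    \<comment> \<open>\<open>w\<close> has leading digit 1 at all edges of the vertex at once and
      residue 0 in the chains without an edge there; \<open>distinct_chains\<close> makes
      \<open>map_of\<close> find every edge.\<close>
    let ?r = "\<lambda>c. case map_of (edges i j) c of Some a \<Rightarrow> chain_prime c ^ a | None \<Rightarrow> 0"
    obtain w where w: "q dvd w - 0" "\<And>c. c < 4 \<Longrightarrow> chain_prime c ^ Suc (k * k) dvd w - ?r c"
      using residues_exist[of 0 ?r] by blast
    have e_props: "fst e < 4" "Suc (snd e) \<le> k * k"
      "chain_prime (fst e) ^ Suc (snd e) dvd w - chain_prime (fst e) ^ snd e"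
      "chain_prime (fst e) ^ Suc (snd e) dvd w - U e"
      if e: "e \<in> set (edges i j)" for e
    proof -
      show r: "fst e < 4" "Suc (snd e) \<le> k * k"
        using edges_range[OF ij, of "fst e" "snd e"] e by auto
      have "map_of (edges i j) (fst e) = Some (snd e)"
        using distinct_chains e by (simp add: map_of_eq_Some_iff)
      then have 1: "chain_prime (fst e) ^ Suc (k * k) dvd w - chain_prime (fst e) ^ snd e"
        using w(2)[OF r(1)] by simp
      have 2: "chain_prime (fst e) ^ Suc (k * k) dvd U e - chain_prime (fst e) ^ snd e"
        using U(2)[OF r(1), of e] by simp
      have "chain_prime (fst e) ^ Suc (snd e) dvd chain_prime (fst e) ^ Suc (k * k)"
        using r(2) by (intro le_imp_power_dvd) simp
      then show "chain_prime (fst e) ^ Suc (snd e) dvd w - chain_prime (fst e) ^ snd e"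
        "chain_prime (fst e) ^ Suc (snd e) dvd w - U e"
        using 1 dvd_diff[OF 1 2] by (auto intro: dvd_trans simp del: power_Suc)
    qed
    have "map (\<lambda>e. chi e w) (edges i j) = map (\<lambda>_. 1) (edges i j)"
      using chi_1(2)[OF e_props(3)] by simp
    then have "gadget False i j w"
      using chi_1(1)[OF e_props(3)] by (simp add: gadget_def twist_def map_replicate_const)
    then have "gadget True i j (F w - F 0)"
      using transfer[OF _ rel_gadget(2)[OF ij], of w 0] rel_gadget(1)[OF ij] w(1) by simp
    then have prod: "prod_list (map (\<lambda>e. chi e (F w - F 0)) (edges i j)) = twist True i j"
      by (simp add: gadget_def)
    \<comment> \<open>\<open>w\<close> and \<open>U e\<close> agree modulo the power after the level
      of \<open>e\<close>. This congruence is itself a label, so \<open>F\<close> preserves it and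
      \<open>chi\<close> takes the same value on both images.\<close>
    have "chi e (F w - F 0) = f e" if e: "e \<in> set (edges i j)" for e
      unfolding f_def
    proof (rule exactly_chi_cong)
      have "q dvd w - U e" using dvd_diff[OF w(1) U(1)[of e]] by simp
      then have "chain_prime (fst e) ^ Suc (snd e) dvd F (U e + (w - U e)) - F (U e)"
        using transfer[OF _ rel_level(2)[OF e_props(1,2)[OF e]], of "w - U e" "U e"]
          rel_level(1)[OF e_props(1,2)[OF e]] e_props(4)[OF e] by blast
      then show "chain_prime (fst e) ^ Suc (snd e) dvd F w - F 0 - (F (U e) - F 0)" by simp
    qed
    then have "map (\<lambda>e. chi e (F w - F 0)) (edges i j) = map f (edges i j)" by simp
    with prod show ?thesis by (simp only:)
  qed
  then have "(\<Prod>i<k. \<Prod>j<k. prod_list (map f (edges i j))) = -1"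
    using prod_twist by simp
  moreover have "sign_valued f" using chi_sign by (simp add: f_def)
  ultimately show False using prod_edges by simp
qed

end

section \<open>The circulant graphs\<close>

text \<open>Residues are natural numbers because \<open>wl_dimension\<close> takes graphs on
  \<open>nat\<close>.\<close>

definition zmod :: "nat \<Rightarrow> nat monoid" where
  "zmod n = \<lparr>carrier = {..<n}, monoid.mult = (\<lambda>x y. (x + y) mod n), one = 0\<rparr>"

lemma zmod_simps:
  "carrier (zmod n) = {..<n}" "x \<otimes>\<^bsub>zmod n\<^esub> y = (x + y) mod n" "\<one>\<^bsub>zmod n\<^esub> = 0"
  by (simp_all add: zmod_def)

lemma group_zmod:
  assumes "0 < n"
  shows "group (zmod n)"
proof (rule groupI)
  fix x assume "x \<in> carrier (zmod n)"
  then have "x < n" by (simp add: zmod_simps)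
  then have "((n - x) mod n + x) mod n = 0" by (simp add: mod_add_left_eq)
  then show "\<exists>y\<in>carrier (zmod n). y \<otimes>\<^bsub>zmod n\<^esub> x = \<one>\<^bsub>zmod n\<^esub>"
    using assms by (intro bexI[of _ "(n - x) mod n"]) (auto simp: zmod_simps)
qed (use assms in \<open>auto simp: zmod_simps mod_add_left_eq mod_add_right_eq add.assoc\<close>)

lemma inv_zmod:
  assumes "x < n"
  shows "inv\<^bsub>zmod n\<^esub> x = (n - x) mod n"
proof -
  interpret group "zmod n" using assms by (intro group_zmod) simp
  have "((n - x) mod n + x) mod n = 0" using assms by (simp add: mod_add_left_eq)
  then show ?thesis using assms by (intro inv_equality) (auto simp: zmod_simps)
qed

lemma cyclic_zmod:
  assumes "0 < n"
  shows "cyclic_group (zmod n)"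
proof -
  interpret group "zmod n" using assms by (rule group_zmod)
  \<comment> \<open>The generator is \<open>1 mod n\<close>, which covers the trivial group at
    \<open>n = 1\<close>.\<close>
  have one: "1 mod n \<in> carrier (zmod n)" using assms by (simp add: zmod_simps)
  have pow: "(1 mod n) [^]\<^bsub>zmod n\<^esub> (l::nat) = l mod n" for l
    by (induction l) (simp_all add: nat_pow_Suc zmod_simps mod_simps)
  have "carrier (zmod n) \<subseteq> range (\<lambda>i::int. (1 mod n) [^]\<^bsub>zmod n\<^esub> i)"
  proof
    fix x assume "x \<in> carrier (zmod n)"
    then have "x = (1 mod n) [^]\<^bsub>zmod n\<^esub> int x" using pow[of x] by (simp add: zmod_simps int_pow_int)
    then show "x \<in> range (\<lambda>i::int. (1 mod n) [^]\<^bsub>zmod n\<^esub> i)" by blast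
  qed
  then have "carrier (zmod n) = range (\<lambda>i::int. (1 mod n) [^]\<^bsub>zmod n\<^esub> i)"
    using int_pow_closed[OF one] by blast
  then show ?thesis using cyclic_group one by blast
qed

context grid
begin

definition graph :: "bool \<Rightarrow> nat pair_pre_digraph" where
  "graph b = cayley_graph (zmod modulus) {x. x < modulus \<and> conn b (int x)}"

lemma pverts_graph: "pverts (graph b) = {..<modulus}"
  by (simp add: graph_def cayley_graph_def zmod_simps)

lemma parcs_graph:
  "(x, y) \<in> parcs (graph b) \<longleftrightarrow> x < modulus \<and> y < modulus \<and> conn b (int y - int x)"
proof -
  have "conn b (int ((y + (modulus - x) mod modulus) mod modulus)) \<longleftrightarrow> conn b (int y - int x)"
    if "x < modulus"
  proof (rule conn_cong)
    have "int ((y + (modulus - x) mod modulus) mod modulus) = (int y - int x) mod (q * g)"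
      using that by (simp add: mod_add_right_eq zmod_int of_nat_diff flip: int_modulus)
        (metis add_diff_eq add_diff_eq mod_add_self2 diff_add_eq)
    then show "q * g dvd int ((y + (modulus - x) mod modulus) mod modulus) - (int y - int x)"
      by (simp add: mod_eq_dvd_iff[symmetric])
  qed
  then show ?thesis
    using modulus_pos by (auto simp: graph_def cayley_graph_def zmod_simps inv_zmod)
qed

lemma circulant_graph: "circulant (graph b)"
  unfolding circulant_def graph_def using group_zmod[OF modulus_pos] cyclic_zmod[OF modulus_pos]
  by (intro exI[of _ "zmod modulus"] exI[of _ "{x. x < modulus \<and> conn b (int x)}"]) (auto simp: zmod_simps)

lemma pair_fin_digraph_graph: "pair_fin_digraph (graph b)"
proof
  fix e assume "e \<in> parcs (graph b)"
  then show "fst e \<in> pverts (graph b)" "snd e \<in> pverts (graph b)"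
    by (cases e; simp add: parcs_graph pverts_graph)+
next
  show "finite (pverts (graph b))" by (simp add: pverts_graph)
  show "finite (parcs (graph b))"
    by (rule finite_subset[of _ "{..<modulus} \<times> {..<modulus}"]) (auto simp: parcs_graph)
qed

lemma graph_equivalent:
  assumes "2 * m < k"
  shows "wl_equivalent m (graph False) (graph True)"
proof -
  interpret wl_game "graph False" "graph True" m position
  proof
    show "\<exists>\<phi>. bij_betw \<phi> (pverts (graph False)) (pverts (graph True)) \<and>
        (\<forall>\<alpha>\<in>pverts (graph False). position (\<alpha> # x) (\<phi> \<alpha> # y))"
      if "position x y" "length x \<le> m" "set x \<subseteq> pverts (graph False)" for x y
      using position_extend[OF that(1,2) assms] that(3) by (auto simp: pverts_graph)
    show "(x ! i, x ! j) \<in> parcs (graph False) \<longleftrightarrow> (y ! i, y ! j) \<in> parcs (graph True)"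
      if "position x y" "set x \<subseteq> pverts (graph False)" "set y \<subseteq> pverts (graph True)"
        "i < length x" "j < length x" for x y i j
    proof -
      have "length y = length x" using that(1) by (simp add: position_def)
      then have "x ! i \<in> set x" "x ! j \<in> set x" "y ! i \<in> set y" "y ! j \<in> set y"
        using that(4,5) by simp_all
      then show ?thesis
        using position_conn_iff[OF that(1,5,4)] that(2,3) by (auto simp: parcs_graph pverts_graph)
    qed
  qed (use assms position_trivial position_eq_iff position_restrict in \<open>auto simp: pverts_graph\<close>)
  show ?thesis by (rule wl_equivalent)
qed

text \<open>\<open>conn_not_iso\<close> expects a map on the integers from the untwisted to the
  twisted graph, so the isomorphism is inverted and composed with reduction modulo
  \<open>q * g\<close>.\<close>

lemma graph_not_iso: "\<not> digraph_iso (with_proj (graph True)) (with_proj (graph False))"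
proof
  assume iso: "digraph_iso (with_proj (graph True)) (with_proj (graph False))"
  have wf: "pair_wf_digraph (graph True)"
    using pair_fin_digraph_graph by (simp add: pair_fin_digraph_def)
  obtain f where f: "bij_betw f {..<modulus} {..<modulus}"
    and f_arcs: "\<And>x y. x < modulus \<Longrightarrow> y < modulus \<Longrightarrow>
      conn True (int y - int x) \<longleftrightarrow> conn False (int (f y) - int (f x))"
  proof (rule digraph_isoD[OF iso wf])
    fix f assume *: "bij_betw f (pverts (graph True)) (pverts (graph False))"
      "\<And>x y. x \<in> pverts (graph True) \<Longrightarrow> y \<in> pverts (graph True) \<Longrightarrow>
        (x, y) \<in> parcs (graph True) \<longleftrightarrow> (f x, f y) \<in> parcs (graph False)"
    have bij: "bij_betw f {..<modulus} {..<modulus}" using *(1) by (simp add: pverts_graph)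
    show thesis
      by (rule that[OF bij]) (use *(2) bij_betw_apply[OF bij] in \<open>simp add: pverts_graph parcs_graph\<close>)
  qed
  define h where "h = inv_into {..<modulus} f"
  have h: "bij_betw h {..<modulus} {..<modulus}" unfolding h_def by (rule bij_betw_inv_into[OF f])
  have h_less: "h x < modulus" if "x < modulus" for x using bij_betw_apply[OF h, of x] that by simp
  have h_arcs: "conn False (int y - int x) \<longleftrightarrow> conn True (int (h y) - int (h x))"
    if "x < modulus" "y < modulus" for x y
    using f_arcs[OF h_less[OF that(1)] h_less[OF that(2)]] that
      bij_betw_inv_into_right[OF f] by (simp add: h_def)
  have N: "0 < q * g" using q_pos g_pos by simp
  define r where "r z = nat (z mod (q * g))" for z
  have int_r: "int (r z) = z mod (q * g)" for z using N by (simp add: r_def)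
  have r_less: "r z < modulus" for z
    using int_r[of z] int_modulus pos_mod_bound[OF N, of z] by linarith
  have r_of_nat: "r (int v) = v" if "v < modulus" for v
    using that by (simp add: r_def flip: int_modulus)
  show False
  proof (rule conn_not_iso[where F = "\<lambda>z. int (h (r z))"])
    fix x y z :: int
    have "q * g dvd (y - x) - (int (r y) - int (r x))"
      unfolding int_r by (simp add: mod_diff_eq flip: mod_eq_dvd_iff)
    then show "conn False (y - x) \<longleftrightarrow> conn True (int (h (r y)) - int (h (r x)))"
      using conn_cong h_arcs[OF r_less r_less] by blast
    have "q * g dvd int (h (r x)) - int (h (r y)) \<longleftrightarrow> h (r x) = h (r y)"
      using eq_if_dvd_diff[OF h_less[OF r_less] h_less[OF r_less]] by auto
    also have "\<dots> \<longleftrightarrow> r x = r y"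
      using h r_less by (auto simp: bij_betw_def inj_on_def)
    also have "\<dots> \<longleftrightarrow> int (r x) = int (r y)" by simp
    also have "\<dots> \<longleftrightarrow> q * g dvd x - y" by (simp only: int_r mod_eq_dvd_iff)
    finally show "q * g dvd int (h (r x)) - int (h (r y)) \<longleftrightarrow> q * g dvd x - y" .
    have "r z \<in> h ` {..<modulus}" using h r_less[of z] by (simp add: bij_betw_def)
    then obtain v where v: "v < modulus" "h v = r z" by auto
    have "q * g dvd int (h (r (int v))) - z"
      using v by (simp add: r_of_nat int_r flip: mod_eq_dvd_iff)
    then show "\<exists>x. q * g dvd int (h (r x)) - z" by blast
  qed
qed

lemma wl_dimension_graph: "real k / 2 \<le> real (wl_dimension (graph False))"
proof -
  \<comment> \<open>The condition \<open>m < (k + 1) div 2\<close> is equivalent to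
    \<open>2 * m < k\<close>.\<close>
  have "(k + 1) div 2 \<le> wl_dimension (graph False)"
  proof (rule wl_dimension_geI[OF pair_fin_digraph_graph])
    fix m :: nat assume m: "0 < m" "m < (k + 1) div 2"
    then have "2 * m < k" by linarith
    then show "\<exists>\<Delta>. pair_fin_digraph \<Delta> \<and> wl_equivalent m (graph False) \<Delta> \<and>
        \<not> digraph_iso (with_proj \<Delta>) (with_proj (graph False))"
      using pair_fin_digraph_graph graph_equivalent graph_not_iso by blast
  qed
  then show ?thesis by linarith
qed

lemma modulus_gt: "k < modulus"
proof -
  have "k \<le> k * k" by simp
  then have "k < num_labels" unfolding num_labels_def by linarith
  moreover have "q \<le> q * g" using q_pos g_pos by (simp add: mult_le_cancel_left1)
  ultimately show ?thesis using num_labels_less int_modulus by linarith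
qed

lemma sqrt_ln_modulus: "sqrt (ln (real modulus)) \<le> 5 * real k"
proof -
  have "{..<4} = {0, 1, 2, 3::nat}" by auto
  \<comment> \<open>1155 is 3 * 5 * 7 * 11 and lies below \<open>2 ^ 11\<close>. Together with
    \<open>q\<close> the exponent of 2 is \<open>12 * (k * k) + 17\<close>, at most
    \<open>25 * (k * k)\<close> for \<open>k \<ge> 2\<close>.\<close>
  then have "g = 1155 ^ Suc (k * k)"
    by (simp add: g_def chain_prime_def power_mult_distrib[symmetric] del: power_Suc)
  also have "\<dots> \<le> (2 ^ 11) ^ Suc (k * k)" by (rule power_mono) simp_all
  finally have "q * g \<le> 2 ^ (k * k + 6) * (2 ^ 11) ^ Suc (k * k)"
    unfolding q_def by (intro mult_left_mono) simp_all
  also have "\<dots> = 2 ^ (12 * (k * k) + 17)"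
  proof -
    have "k * k + 6 + 11 * Suc (k * k) = 12 * (k * k) + 17" by simp
    then show ?thesis by (simp only: power_mult[symmetric] power_add[symmetric])
  qed
  finally have "int modulus \<le> int (2 ^ (12 * (k * k) + 17))" by (simp add: int_modulus)
  then have "real modulus \<le> 2 ^ (12 * (k * k) + 17)"
    by (metis of_nat_le_iff of_nat_numeral of_nat_power)
  then have "ln (real modulus) \<le> ln (2 ^ (12 * (k * k) + 17))"
    using modulus_pos by (subst ln_le_cancel_iff) simp_all
  also have "\<dots> = real (12 * (k * k) + 17) * ln 2" by (simp only: ln_realpow)
  also have "\<dots> \<le> real (12 * (k * k) + 17) * 1"
    using ln_le_minus_one[of 2] by (intro mult_left_mono) simp_all
  also have "\<dots> \<le> real (25 * (k * k))"
  proof -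
    have "2 * 2 \<le> k * k" using k_ge by (intro mult_mono) simp_all
    then have "12 * (k * k) + 17 \<le> 25 * (k * k)" by linarith
    then show ?thesis by (metis mult.right_neutral of_nat_le_iff)
  qed
  finally have "ln (real modulus) \<le> (5 * real k)\<^sup>2"
    by (simp add: power2_eq_square)
  then show ?thesis by (intro real_le_lsqrt) simp_all
qed

end

theorem corollary1p2:
  shows "\<exists>c :: real. c > 0 \<and>
    infinite {n :: nat. n > 0 \<and>
      (\<exists>\<Gamma> :: nat pair_pre_digraph. circulant \<Gamma> \<and> card (pverts \<Gamma>) = n \<and>
         real (wl_dimension \<Gamma>) \<ge> c * sqrt (ln (real n)))}"
proof (intro exI[of _ "1 / 10"] conjI)
  show "infinite {n :: nat. n > 0 \<and>
      (\<exists>\<Gamma> :: nat pair_pre_digraph. circulant \<Gamma> \<and> card (pverts \<Gamma>) = n \<and>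
         real (wl_dimension \<Gamma>) \<ge> 1 / 10 * sqrt (ln (real n)))}"
    unfolding infinite_nat_iff_unbounded_le
  proof
    fix m :: nat
    interpret grid "m + 2" by unfold_locales simp
    \<comment> \<open>With \<open>k = m + 2\<close> the dimension is at least \<open>k / 2\<close>
      and the square root at most \<open>5 * k\<close>, which gives the constant 1/10.\<close>
    have "1 / 10 * sqrt (ln (real modulus)) \<le> real (wl_dimension (graph False))"
      using sqrt_ln_modulus wl_dimension_graph by linarith
    moreover have "card (pverts (graph False)) = modulus" by (simp only: pverts_graph card_lessThan)
    moreover have "m \<le> modulus" using modulus_gt by simp
    ultimately show "\<exists>n\<ge>m. n \<in> {n :: nat. n > 0 \<and>
      (\<exists>\<Gamma> :: nat pair_pre_digraph. circulant \<Gamma> \<and> card (pverts \<Gamma>) = n \<and>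
         real (wl_dimension \<Gamma>) \<ge> 1 / 10 * sqrt (ln (real n)))}"
      using circulant_graph modulus_pos by blast
  qed
qed simp

end
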